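(* Let $G$ be a 4-dimensional real Lie group with a left-invariant Riemannian metric $g$, and let $\{X,Y,Z,W\}$ be an orthonormal basis of its Lie algebra of left-invariant vector fields whose Lie brackets are those of one of the twenty families $\mathfrak g_1,\dots,\mathfrak g_{20}$ listed in the context (with the parameter restrictions stated there). Let $J$ be the left-invariant almost complex structure with $JX=Y$, $JY=-X$, $JZ=W$, $JW=-Z$. Then $J$ is almost Kähler (AK), integrable (I), respectively Kähler (K), if and only if the corresponding condition on the parameters holds ("never" means that it holds for no admissible parameters, "always" that it holds for all admissible parameters): - $\mathfrak g_1$: AK iff $w_1=0$; I iff $w_1=w_2=0$; K iff $w_1=w_2=0$. - $\mathfrak g_2$: AK iff $\alpha=0$; I iff $w_1=w_2=0$; K iff $\alpha=w_1=w_2=0$. - $\mathfrak g_3$: AK iff $\theta_2=-2\alpha\neq0$; I iff $w_1=w_2=0$; K iff $\theta_2=-2\alpha\ne0$ and $w_1=w_2=0$. - $\mathfrak g_4$: AK iff $2\lambda^2=z_2w_1$; I iff $2z_2+w_1=w_2=0$; K never. - $\mathfrak g_5$: AK iff $r^2=4(\alpha b-a\beta)$; I iff $a=\beta$ and $b=-\alpha$; K never. - $\mathfrak g_6$: AK iff $\theta_1=\theta_2=0$; I iff $r=\frac{z_1^2+z_3^2}{z_3}$ and $z_2=\frac{z_1^2-z_3^2}{2z_3}$; K iff $\theta_1=\theta_2=0$, $r=\frac{z_1^2+z_3^2}{z_3}$ and $z_2=\frac{z_1^2-z_3^2}{2z_3}$. - $\mathfrak g_7$: AK iff $\theta_1=\theta_2=0$;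 I iff $2z_2+w_1=w_2=0$; K iff $\theta_1=\theta_2=0$ and $2z_2+w_1=w_2=0$. - $\mathfrak g_8$: AK iff $\theta_1=\theta_2=0$; I iff $2z_2=z_4+w_2=0$; K iff $\theta_1=\theta_2=0$ and $2z_2=z_4+w_2=0$. - $\mathfrak g_9$ (where $r=-2z_2$): AK iff $\theta_1=\theta_2=0$; I iff $z_3-r=z_4=0$; K iff $\theta_1=\theta_2=0$ and $z_3-r=z_4=0$. - $\mathfrak g_{10}$: AK never; I always; K never. - $\mathfrak g_{11}$: AK iff $\theta_1=\theta_2=0$; I never; K never. - $\mathfrak g_{12}$: AK iff $\theta_1=\theta_2=0$; I iff $z_3=-w_1\neq0$; K iff $\theta_1=\theta_2=0$ and $z_3=-w_1\ne0$. - $\mathfrak g_{13}$: AK iff $\theta_1=\theta_2=0$; I never; K never. - $\mathfrak g_{14}$: AK iff $\theta_1=\theta_2=0$; I iff $z_2=z_4+w_2=0$; K iff $\theta_1=\theta_2=0$ and $z_2=z_4+w_2=0$. - $\mathfrak g_{15}$: AK never; I iff $w_1=w_2=0$; K never. - $\mathfrak g_{16}$: AK iff $\theta_1=\theta_2=0$; I iff $w_1=w_2=0$; K iff $\theta_1=\theta_2=0$ and $w_1=w_2=0$. - $\mathfrak g_{17}$: AK never; I iff $w_1=w_2=0$; K never. - $\mathfrak g_{18}$: AK iff $\theta_1=\theta_2=0$; I iff $z_3=z_4=0$; K iff $\theta_1=\theta_2=0$ and $z_3=z_4=0$. - $\mathfrak g_{19}$: AK never; I iff $w_1=w_2=0$;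 K never. - $\mathfrak g_{20}$: AK never; I iff $w_1=w_2=0$; K never.
   Context: Definitions. The Kähler form of $(G,g,J)$ is the 2-form $\omega(E,F)=g(JE,F)$. $J$ is called almost Kähler if $d\omega=0$. $J$ is integrable if its Nijenhuis tensor $N_J(U,V)=[U,V]+J[JU,V]+J[U,JV]-[JU,JV]$ vanishes identically (equivalently, by the Newlander–Nirenberg theorem, $J$ comes from a complex manifold structure). $J$ is Kähler if it is both almost Kähler and integrable. The twenty families of 4-dimensional real Lie algebras. All parameters are real; brackets of basis elements not listed (and not obtained from the listed ones by antisymmetry) are zero. $\mathfrak g_1(\lambda,r,w_1,w_2)$, $\lambda\ne0$, $r\neq0$: $[W,Z]=\lambda W$, $[Z,X]=w_1W$, $[Z,Y]=w_2W$, $[Y,X]=rX+\frac{rw_1}{\lambda}W$. $\mathfrak g_2(\lambda,\alpha,\beta,w_1,w_2)$, $\lambda\ne0$, $(\lambda-\alpha)^2+\beta^2\neq0$: $[W,Z]=\lambda W$, $[Z,X]=\alpha X+\beta Y+w_1W$, $[Z,Y]=-\beta X+\alpha Y+w_2W$. $\mathfrak g_3(\alpha,\beta,w_1,w_2,\theta_2)$, $\alpha\ne0$, $\theta_2\neq0$: $[W,Z]=-2\alpha W$, $[Z,X]=\alpha X+\beta Y+w_1W$, $[Z,Y]=-\beta X+\alpha Y+w_2W$, $[Y,X]=\theta_2W$. $\mathfrak g_4(\lambda,z_2,w_1,w_2)$, $\lambda\neq0$: $[W,Z]=\lambda W$, $[Z,X]=\lambda X+w_1W$, $[Z,Y]=\lambda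 Y+z_2Z+w_2W$, $[W,Y]=-z_2W$, $[Y,X]=-z_2X-\frac{z_2w_1}{\lambda}W$. $\mathfrak g_5(\alpha,a,\beta,b,r)$, $r\neq0$, $a\beta-\alpha b\neq0$: $[Z,X]=\alpha X+\beta Y+\frac{r(\beta b-\alpha a)}{2(a\beta-\alpha b)}Z+\frac{r(\alpha^2-\beta^2)}{2(a\beta-\alpha b)}W$, $[Z,Y]=-\beta X+\alpha Y+\frac{r(\alpha b+\beta a)}{2(a\beta-\alpha b)}Z-\frac{r\alpha\beta}{a\beta-\alpha b}W$, $[W,X]=aX+bY+\frac{r(b^2-a^2)}{2(a\beta-\alpha b)}Z+\frac{r(\alpha a-\beta b)}{2(a\beta-\alpha b)}W$, $[W,Y]=-bX+aY+\frac{rab}{a\beta-\alpha b}Z-\frac{r(\alpha b+\beta a)}{2(a\beta-\alpha b)}W$, $[Y,X]=rX-\frac{ar^2}{2(a\beta-\alpha b)}Z+\frac{\alpha r^2}{2(a\beta-\alpha b)}W$. $\mathfrak g_6(z_1,z_2,z_3,r,\theta_1,\theta_2)$, $z_1\ne0$, $z_3\neq0$, $r\neq0$: $[Z,X]=z_1Z-\frac{z_1^2}{z_3}W$, $[Z,Y]=z_2Z+\frac{z_1(r-2z_2)}{2z_3}W$, $[W,X]=z_3Z-z_1W$, $[W,Y]=\frac{z_3(r+2z_2)}{2z_1}Z-z_2W$, $[Y,X]=rX+\theta_1Z+\theta_2W$. $\mathfrak g_7(z_2,w_1,w_2,\theta_1,\theta_2)$, $z_2\ne0$, $w_1\neq0$: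 $[Z,X]=w_1W$, $[Z,Y]=z_2Z+w_2W$, $[W,Y]=-z_2W$, $[Y,X]=2z_2X+\theta_1Z+\theta_2W$. $\mathfrak g_8(z_2,z_4,w_2,r,\theta_1,\theta_2)$, $r\neq0$: $[Z,Y]=z_2Z+w_2W$, $[W,Y]=z_4Z-z_2W$, $[Y,X]=rX+\theta_1Z+\theta_2W$. $\mathfrak g_9(z_2,z_3,z_4,\theta_1,\theta_2)$, $z_2\ne0$, $z_3\neq0$, and $r:=-2z_2$: $[Z,Y]=z_2Z$, $[W,X]=z_3Z$, $[W,Y]=z_4Z-z_2W$, $[Y,X]=-2z_2X+\theta_1Z+\theta_2W$. $\mathfrak g_{10}(\alpha,a,\beta,b)$, $\alpha b-a\beta\neq0$: $[Z,X]=\alpha X+\beta Y$, $[Z,Y]=-\beta X+\alpha Y$, $[W,X]=aX+bY$, $[W,Y]=-bX+aY$. $\mathfrak g_{11}(z_1,z_2,z_3,w_1,\theta_1,\theta_2)$, $z_1\neq0$: $[Z,X]=z_1Z+w_1W$, $[Z,Y]=z_2Z+\frac{z_2w_1}{z_1}W$, $[W,X]=z_3Z-z_1W$, $[W,Y]=\frac{z_2z_3}{z_1}Z-z_2W$, $[Y,X]=\theta_1Z+\theta_2W$. $\mathfrak g_{12}(z_3,w_1,w_2,\theta_1,\theta_2)$, $w_1\neq0$: $[Z,X]=w_1W$, $[Z,Y]=w_2W$, $[W,X]=z_3Z$, $[W,Y]=\frac{z_3w_2}{w_1}Z$, $[Y,X]=\theta_1Z+\theta_2W$. $\mathfrak g_{13}(z_3,z_4,\theta_1,\theta_2)$,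 $z_3\neq0$: $[W,X]=z_3Z$, $[W,Y]=z_4Z$, $[Y,X]=\theta_1Z+\theta_2W$. $\mathfrak g_{14}(z_2,z_4,w_2,\theta_1,\theta_2)$: $[Z,Y]=z_2Z+w_2W$, $[W,Y]=z_4Z-z_2W$, $[Y,X]=\theta_1Z+\theta_2W$. $\mathfrak g_{15}(\alpha,w_1,w_2)$, $\alpha\neq0$: $[Z,X]=\alpha X+w_1W$, $[Z,Y]=\alpha Y+w_2W$. $\mathfrak g_{16}(\beta,w_1,w_2,\theta_1,\theta_2)$, $\beta\neq0$: $[Z,X]=\beta Y+w_1W$, $[Z,Y]=-\beta X+w_2W$, $[Y,X]=\theta_1Z+\theta_2W$. $\mathfrak g_{17}(\alpha,a,w_1,w_2)$, $\alpha\ne0$, $a\neq0$: $[Z,X]=\alpha X-\frac{aw_1}{\alpha}Z+w_1W$, $[Z,Y]=\alpha Y-\frac{aw_2}{\alpha}Z+w_2W$, $[W,X]=aX-\frac{a^2w_1}{\alpha^2}Z+\frac{aw_1}{\alpha}W$, $[W,Y]=aY-\frac{a^2w_2}{\alpha^2}Z+\frac{aw_2}{\alpha}W$. $\mathfrak g_{18}(\beta,b,z_3,z_4,\theta_1,\theta_2)$, $\beta\ne0$, $b\neq0$: $[Z,X]=\beta Y+\frac{\beta z_3}{b}Z-\frac{\beta^2z_3}{b^2}W$, $[Z,Y]=-\beta X+\frac{\beta z_4}{b}Z-\frac{\beta^2z_4}{b^2}W$, $[W,X]=bY+z_3Z-\frac{\beta z_3}{b}W$, $[W,Y]=-bX+z_4Z-\frac{\beta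 z_4}{b}W$, $[Y,X]=\theta_1Z+\theta_2W$. $\mathfrak g_{19}(\alpha,\beta,w_1,w_2)$, $\alpha\ne0$, $\beta\neq0$: $[Z,X]=\alpha X+\beta Y+w_1W$, $[Z,Y]=-\beta X+\alpha Y+w_2W$. $\mathfrak g_{20}(\alpha,a,\beta,w_1,w_2)$, $\alpha\ne0$, $a\ne0$, $\beta\neq0$: $[Z,X]=\alpha X+\beta Y-\frac{aw_1}{\alpha}Z+w_1W$, $[Z,Y]=-\beta X+\alpha Y-\frac{aw_2}{\alpha}Z+w_2W$, $[W,X]=aX+\frac{\beta a}{\alpha}Y-\frac{a^2w_1}{\alpha^2}Z+\frac{a w_1}{\alpha}W$, $[W,Y]=-\frac{\beta a}{\alpha}X+aY-\frac{a^2w_2}{\alpha^2}Z+\frac{a w_2}{\alpha}W$. *)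

theory Defs
  imports "HOL-Analysis.Analysis"
begin

subsection \<open>Smooth maps between open sets of Euclidean spaces\<close>

text \<open>Only used for open \<open>S\<close>: all directional derivatives of order at most \<open>k\<close> exist and are
  continuous (and those of order less than \<open>k\<close> are Frechet differentiable).\<close>

fun Ck_on :: "nat \<Rightarrow> ('a::real_normed_vector \<Rightarrow> 'b::real_normed_vector) \<Rightarrow> 'a set \<Rightarrow> bool" where
  "Ck_on 0 f S \<longleftrightarrow> continuous_on S f"
| "Ck_on (Suc k) f S \<longleftrightarrow> (\<forall>x\<in>S. f differentiable (at x)) \<and>
     (\<forall>v. Ck_on k (\<lambda>x. frechet_derivative f (at x) v) S)"

definition Cinf_on :: "('a::real_normed_vector \<Rightarrow> 'b::real_normed_vector) \<Rightarrow> 'a set \<Rightarrow> bool" where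
  "Cinf_on f S \<longleftrightarrow> (\<forall>k. Ck_on k f S)"

subsection \<open>Smooth 4-manifolds\<close>

text \<open>The manifold is the whole type \<open>'a\<close>; Hausdorff and second countable by its sort. The smooth
  structure is given by an atlas, a set of pairs of an open domain and a coordinate map.\<close>

type_synonym 'a atlas = "('a set \<times> ('a \<Rightarrow> real^4)) set"

definition smooth_atlas :: "'a::{t2_space, second_countable_topology} atlas \<Rightarrow> bool" where
  "smooth_atlas A \<longleftrightarrow>
     (\<Union>(U, \<phi>)\<in>A. U) = UNIV \<and>
     (\<forall>(U, \<phi>)\<in>A. open U \<and> open (\<phi> ` U) \<and> homeomorphism U (\<phi> ` U) \<phi> (inv_into U \<phi>)) \<and>
     (\<forall>(U, \<phi>)\<in>A. \<forall>(V, \<psi>)\<in>A. Cinf_on (\<psi> \<circ> inv_into U \<phi>) (\<phi> ` (U \<inter> V)))"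

definition smooth_fun :: "'a atlas \<Rightarrow> ('a \<Rightarrow> real) \<Rightarrow> bool" where
  "smooth_fun A f \<longleftrightarrow> (\<forall>(U, \<phi>)\<in>A. Cinf_on (f \<circ> inv_into U \<phi>) (\<phi> ` U))"

subsection \<open>Lie groups of dimension 4\<close>

text \<open>The set in the last two conditions is the coordinate domain of the map; it is open because
  the group operations are continuous.\<close>

definition lie_group4 ::
  "('a::{t2_space, second_countable_topology} \<Rightarrow> 'a \<Rightarrow> 'a) \<Rightarrow> 'a \<Rightarrow> ('a \<Rightarrow> 'a) \<Rightarrow> 'a atlas \<Rightarrow> bool" where
  "lie_group4 mul e iv A \<longleftrightarrow>
     group mul e iv \<and>
     smooth_atlas A \<and>
     continuous_on UNIV (\<lambda>(x, y). mul x y) \<and>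
     continuous_on UNIV iv \<and>
     (\<forall>(U, \<phi>)\<in>A. \<forall>(V, \<psi>)\<in>A. \<forall>(T, \<tau>)\<in>A.
        Cinf_on (\<lambda>(a, b). \<tau> (mul (inv_into U \<phi> a) (inv_into V \<psi> b)))
          {(a, b). a \<in> \<phi> ` U \<and> b \<in> \<psi> ` V \<and> mul (inv_into U \<phi> a) (inv_into V \<psi> b) \<in> T}) \<and>
     (\<forall>(U, \<phi>)\<in>A. \<forall>(T, \<tau>)\<in>A.
        Cinf_on (\<lambda>a. \<tau> (iv (inv_into U \<phi> a))) {a. a \<in> \<phi> ` U \<and> iv (inv_into U \<phi> a) \<in> T})"

subsection \<open>Tangent vectors and vector fields\<close>

text \<open>A tangent vector at \<open>p\<close> is a directional derivative: the functional
  \<open>\<Sum>i. \<xi>\<^sub>i (\<partial>/\<partial>x\<^sub>i)\<close> at \<open>p\<close> on smooth functions, in the coordinates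
  of some chart around \<open>p\<close>. On non-smooth functions it takes the dummy value 0, so that equality of
  tangent vectors is equality in HOL.\<close>

type_synonym 'a tangent = "('a \<Rightarrow> real) \<Rightarrow> real"
type_synonym 'a vfield = "'a \<Rightarrow> 'a tangent"

definition tangent_space :: "'a atlas \<Rightarrow> 'a \<Rightarrow> 'a tangent set" where
  "tangent_space A p =
     {v. \<exists>(U, \<phi>)\<in>A. p \<in> U \<and> (\<exists>\<xi>. v = (\<lambda>f.
        if smooth_fun A f then frechet_derivative (f \<circ> inv_into U \<phi>) (at (\<phi> p)) \<xi> else 0))}"

definition vector_fields :: "'a atlas \<Rightarrow> 'a vfield set" where
  "vector_fields A =
     {V. (\<forall>p. V p \<in> tangent_space A p) \<and>
         (\<forall>f. smooth_fun A f \<longrightarrow> smooth_fun A (\<lambda>p. V p f))}"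

definition lie_bracket :: "'a atlas \<Rightarrow> 'a vfield \<Rightarrow> 'a vfield \<Rightarrow> 'a vfield" where
  "lie_bracket A U V = (\<lambda>p f.
     if smooth_fun A f then U p (\<lambda>q. V q f) - V p (\<lambda>q. U q f) else 0)"

definition vzero :: "'a vfield" where
  "vzero = (\<lambda>p f. 0)"

definition vadd :: "'a vfield \<Rightarrow> 'a vfield \<Rightarrow> 'a vfield" (infixl "\<oplus>" 65) where
  "U \<oplus> V = (\<lambda>p f. U p f + V p f)"

definition vscale :: "real \<Rightarrow> 'a vfield \<Rightarrow> 'a vfield" (infixr "\<odot>" 70) where
  "c \<odot> V = (\<lambda>p f. c * V p f)"

text \<open>The differential at a point of a diffeomorphism \<open>F\<close>, here a left translation.\<close>

definition push :: "('a \<Rightarrow> 'a) \<Rightarrow> 'a tangent \<Rightarrow> 'a tangent" where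
  "push F v = (\<lambda>f. v (f \<circ> F))"

definition lie_algebra :: "('a \<Rightarrow> 'a \<Rightarrow> 'a) \<Rightarrow> 'a atlas \<Rightarrow> 'a vfield set" where
  "lie_algebra mul A =
     {V \<in> vector_fields A. \<forall>h p. V (mul h p) = push (mul h) (V p)}"

subsection \<open>Left-invariant metrics and almost complex structures\<close>

type_synonym 'a tensor2 = "'a \<Rightarrow> 'a tangent \<Rightarrow> 'a tangent \<Rightarrow> real"
type_synonym 'a endo = "'a \<Rightarrow> 'a tangent \<Rightarrow> 'a tangent"

definition riemannian_metric :: "'a atlas \<Rightarrow> 'a tensor2 \<Rightarrow> bool" where
  "riemannian_metric A g \<longleftrightarrow>
     (\<forall>p. \<forall>u\<in>tangent_space A p. \<forall>v\<in>tangent_space A p.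
        g p u v = g p v u \<and>
        (u \<noteq> (\<lambda>f. 0) \<longrightarrow> g p u u > 0) \<and>
        (\<forall>w\<in>tangent_space A p. \<forall>a b.
           g p (\<lambda>f. a * u f + b * v f) w = a * g p u w + b * g p v w)) \<and>
     (\<forall>U\<in>vector_fields A. \<forall>V\<in>vector_fields A. smooth_fun A (\<lambda>p. g p (U p) (V p)))"

definition left_invariant_metric :: "('a \<Rightarrow> 'a \<Rightarrow> 'a) \<Rightarrow> 'a atlas \<Rightarrow> 'a tensor2 \<Rightarrow> bool" where
  "left_invariant_metric mul A g \<longleftrightarrow>
     riemannian_metric A g \<and>
     (\<forall>h p. \<forall>u\<in>tangent_space A p. \<forall>v\<in>tangent_space A p.
        g (mul h p) (push (mul h) u) (push (mul h) v) = g p u v)"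

definition orthonormal_lie_basis ::
  "('a \<Rightarrow> 'a \<Rightarrow> 'a) \<Rightarrow> 'a atlas \<Rightarrow> 'a tensor2 \<Rightarrow>
     'a vfield \<Rightarrow> 'a vfield \<Rightarrow> 'a vfield \<Rightarrow> 'a vfield \<Rightarrow> bool" where
  "orthonormal_lie_basis mul A g X Y Z W \<longleftrightarrow>
     {X, Y, Z, W} \<subseteq> lie_algebra mul A \<and>
     (\<forall>V\<in>lie_algebra mul A. \<exists>a b c d. V = a \<odot> X \<oplus> b \<odot> Y \<oplus> c \<odot> Z \<oplus> d \<odot> W) \<and>
     (\<forall>a b c d. a \<odot> X \<oplus> b \<odot> Y \<oplus> c \<odot> Z \<oplus> d \<odot> W = vzero \<longrightarrow>
        a = 0 \<and> b = 0 \<and> c = 0 \<and> d = 0) \<and>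
     (\<forall>i<4. \<forall>j<4. \<forall>p. g p (([X, Y, Z, W] ! i) p) (([X, Y, Z, W] ! j) p) = (if i = j then 1 else 0))"

definition apply_endo :: "'a endo \<Rightarrow> 'a vfield \<Rightarrow> 'a vfield" where
  "apply_endo J V = (\<lambda>p. J p (V p))"

definition almost_complex :: "'a atlas \<Rightarrow> 'a endo \<Rightarrow> bool" where
  "almost_complex A J \<longleftrightarrow>
     (\<forall>p. \<forall>u\<in>tangent_space A p.
        J p u \<in> tangent_space A p \<and>
        J p (J p u) = (\<lambda>f. - u f) \<and>
        (\<forall>v\<in>tangent_space A p. \<forall>a b.
           J p (\<lambda>f. a * u f + b * v f) = (\<lambda>f. a * J p u f + b * J p v f))) \<and>
     (\<forall>V\<in>vector_fields A. apply_endo J V \<in> vector_fields A)"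

definition left_invariant_almost_complex :: "('a \<Rightarrow> 'a \<Rightarrow> 'a) \<Rightarrow> 'a atlas \<Rightarrow> 'a endo \<Rightarrow> bool" where
  "left_invariant_almost_complex mul A J \<longleftrightarrow>
     almost_complex A J \<and>
     (\<forall>h p. \<forall>u\<in>tangent_space A p. J (mul h p) (push (mul h) u) = push (mul h) (J p u))"

subsection \<open>Almost Kaehler, integrable and Kaehler structures\<close>

definition kahler_form :: "'a tensor2 \<Rightarrow> 'a endo \<Rightarrow> 'a tensor2" where
  "kahler_form g J = (\<lambda>p u v. g p (J p u) v)"

text \<open>The exterior derivative of a 2-form, evaluated on vector fields (invariant formula).\<close>

definition ext_deriv2 ::
  "'a atlas \<Rightarrow> 'a tensor2 \<Rightarrow> 'a vfield \<Rightarrow> 'a vfield \<Rightarrow> 'a vfield \<Rightarrow> 'a \<Rightarrow> real" where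
  "ext_deriv2 A \<omega> U V H p =
     U p (\<lambda>q. \<omega> q (V q) (H q)) - V p (\<lambda>q. \<omega> q (U q) (H q)) + H p (\<lambda>q. \<omega> q (U q) (V q))
     - \<omega> p (lie_bracket A U V p) (H p) + \<omega> p (lie_bracket A U H p) (V p)
     - \<omega> p (lie_bracket A V H p) (U p)"

definition almost_kahler :: "'a atlas \<Rightarrow> 'a tensor2 \<Rightarrow> 'a endo \<Rightarrow> bool" where
  "almost_kahler A g J \<longleftrightarrow>
     (\<forall>U\<in>vector_fields A. \<forall>V\<in>vector_fields A. \<forall>H\<in>vector_fields A. \<forall>p.
        ext_deriv2 A (kahler_form g J) U V H p = 0)"

definition nijenhuis :: "'a atlas \<Rightarrow> 'a endo \<Rightarrow> 'a vfield \<Rightarrow> 'a vfield \<Rightarrow> 'a vfield" where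
  "nijenhuis A J U V =
     lie_bracket A U V
     \<oplus> apply_endo J (lie_bracket A (apply_endo J U) V)
     \<oplus> apply_endo J (lie_bracket A U (apply_endo J V))
     \<oplus> (-1) \<odot> lie_bracket A (apply_endo J U) (apply_endo J V)"

definition integrable_acs :: "'a atlas \<Rightarrow> 'a endo \<Rightarrow> bool" where
  "integrable_acs A J \<longleftrightarrow>
     (\<forall>U\<in>vector_fields A. \<forall>V\<in>vector_fields A. nijenhuis A J U V = vzero)"

definition kahler :: "'a atlas \<Rightarrow> 'a tensor2 \<Rightarrow> 'a endo \<Rightarrow> bool" where
  "kahler A g J \<longleftrightarrow> almost_kahler A g J \<and> integrable_acs A J"

subsection \<open>The twenty families\<close>

text \<open>\<open>br\<close> is the Lie bracket and \<open>X\<close>, \<open>Y\<close>, \<open>Z\<close>, \<open>W\<close> the basis; the parameter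
  restrictions are part of each predicate. The parameter lambda is written \<open>l\<close>.\<close>

type_synonym 'a frame_predicate =
  "('a vfield \<Rightarrow> 'a vfield \<Rightarrow> 'a vfield) \<Rightarrow> 'a vfield \<Rightarrow> 'a vfield \<Rightarrow> 'a vfield \<Rightarrow> 'a vfield \<Rightarrow> bool"

definition family1 :: "real \<Rightarrow> real \<Rightarrow> real \<Rightarrow> real \<Rightarrow> 'a frame_predicate" where
  "family1 l r w1 w2 br X Y Z W \<longleftrightarrow>
     l \<noteq> 0 \<and> r \<noteq> 0 \<and>
     br W Z = l \<odot> W \<and>
     br Z X = w1 \<odot> W \<and>
     br Z Y = w2 \<odot> W \<and>
     br W X = vzero \<and>
     br W Y = vzero \<and>
     br Y X = r \<odot> X \<oplus> (r * w1 / l) \<odot> W"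

definition family2 :: "real \<Rightarrow> real \<Rightarrow> real \<Rightarrow> real \<Rightarrow> real \<Rightarrow> 'a frame_predicate" where
  "family2 l \<alpha> \<beta> w1 w2 br X Y Z W \<longleftrightarrow>
     l \<noteq> 0 \<and> (l - \<alpha>)^2 + \<beta>^2 \<noteq> 0 \<and>
     br W Z = l \<odot> W \<and>
     br Z X = \<alpha> \<odot> X \<oplus> \<beta> \<odot> Y \<oplus> w1 \<odot> W \<and>
     br Z Y = (- \<beta>) \<odot> X \<oplus> \<alpha> \<odot> Y \<oplus> w2 \<odot> W \<and>
     br W X = vzero \<and>
     br W Y = vzero \<and>
     br Y X = vzero"

definition family3 :: "real \<Rightarrow> real \<Rightarrow> real \<Rightarrow> real \<Rightarrow> real \<Rightarrow> 'a frame_predicate" where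
  "family3 \<alpha> \<beta> w1 w2 \<theta>2 br X Y Z W \<longleftrightarrow>
     \<alpha> \<noteq> 0 \<and> \<theta>2 \<noteq> 0 \<and>
     br W Z = (- 2 * \<alpha>) \<odot> W \<and>
     br Z X = \<alpha> \<odot> X \<oplus> \<beta> \<odot> Y \<oplus> w1 \<odot> W \<and>
     br Z Y = (- \<beta>) \<odot> X \<oplus> \<alpha> \<odot> Y \<oplus> w2 \<odot> W \<and>
     br W X = vzero \<and>
     br W Y = vzero \<and>
     br Y X = \<theta>2 \<odot> W"

definition family4 :: "real \<Rightarrow> real \<Rightarrow> real \<Rightarrow> real \<Rightarrow> 'a frame_predicate" where
  "family4 l z2 w1 w2 br X Y Z W \<longleftrightarrow>
     l \<noteq> 0 \<and>
     br W Z = l \<odot> W \<and>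
     br Z X = l \<odot> X \<oplus> w1 \<odot> W \<and>
     br Z Y = l \<odot> Y \<oplus> z2 \<odot> Z \<oplus> w2 \<odot> W \<and>
     br W X = vzero \<and>
     br W Y = (- z2) \<odot> W \<and>
     br Y X = (- z2) \<odot> X \<oplus> (- (z2 * w1 / l)) \<odot> W"

definition family5 :: "real \<Rightarrow> real \<Rightarrow> real \<Rightarrow> real \<Rightarrow> real \<Rightarrow> 'a frame_predicate" where
  "family5 \<alpha> a \<beta> b r br X Y Z W \<longleftrightarrow>
     r \<noteq> 0 \<and> a * \<beta> - \<alpha> * b \<noteq> 0 \<and>
     br W Z = vzero \<and>
     br Z X = \<alpha> \<odot> X
         \<oplus> \<beta> \<odot> Y
         \<oplus> (r * (\<beta> * b - \<alpha> * a) / (2 * (a * \<beta> - \<alpha> * b))) \<odot> Z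
         \<oplus> (r * (\<alpha>^2 - \<beta>^2) / (2 * (a * \<beta> - \<alpha> * b))) \<odot> W \<and>
     br Z Y = (- \<beta>) \<odot> X
         \<oplus> \<alpha> \<odot> Y
         \<oplus> (r * (\<alpha> * b + \<beta> * a) / (2 * (a * \<beta> - \<alpha> * b))) \<odot> Z
         \<oplus> (- (r * \<alpha> * \<beta> / (a * \<beta> - \<alpha> * b))) \<odot> W \<and>
     br W X = a \<odot> X
         \<oplus> b \<odot> Y
         \<oplus> (r * (b^2 - a^2) / (2 * (a * \<beta> - \<alpha> * b))) \<odot> Z
         \<oplus> (r * (\<alpha> * a - \<beta> * b) / (2 * (a * \<beta> - \<alpha> * b))) \<odot> W \<and>
     br W Y = (- b) \<odot> X
         \<oplus> a \<odot> Y
         \<oplus> (r * a * b / (a * \<beta> - \<alpha> * b)) \<odot> Z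
         \<oplus> (- (r * (\<alpha> * b + \<beta> * a) / (2 * (a * \<beta> - \<alpha> * b)))) \<odot> W \<and>
     br Y X = r \<odot> X
         \<oplus> (- (a * r^2 / (2 * (a * \<beta> - \<alpha> * b)))) \<odot> Z
         \<oplus> (\<alpha> * r^2 / (2 * (a * \<beta> - \<alpha> * b))) \<odot> W"

definition family6 :: "real \<Rightarrow> real \<Rightarrow> real \<Rightarrow> real \<Rightarrow> real \<Rightarrow> real \<Rightarrow> 'a frame_predicate" where
  "family6 z1 z2 z3 r \<theta>1 \<theta>2 br X Y Z W \<longleftrightarrow>
     z1 \<noteq> 0 \<and> z3 \<noteq> 0 \<and> r \<noteq> 0 \<and>
     br W Z = vzero \<and>
     br Z X = z1 \<odot> Z \<oplus> (- (z1^2 / z3)) \<odot> W \<and>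
     br Z Y = z2 \<odot> Z \<oplus> (z1 * (r - 2 * z2) / (2 * z3)) \<odot> W \<and>
     br W X = z3 \<odot> Z \<oplus> (- z1) \<odot> W \<and>
     br W Y = (z3 * (r + 2 * z2) / (2 * z1)) \<odot> Z \<oplus> (- z2) \<odot> W \<and>
     br Y X = r \<odot> X \<oplus> \<theta>1 \<odot> Z \<oplus> \<theta>2 \<odot> W"

definition family7 :: "real \<Rightarrow> real \<Rightarrow> real \<Rightarrow> real \<Rightarrow> real \<Rightarrow> 'a frame_predicate" where
  "family7 z2 w1 w2 \<theta>1 \<theta>2 br X Y Z W \<longleftrightarrow>
     z2 \<noteq> 0 \<and> w1 \<noteq> 0 \<and>
     br W Z = vzero \<and>
     br Z X = w1 \<odot> W \<and>
     br Z Y = z2 \<odot> Z \<oplus> w2 \<odot> W \<and>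
     br W X = vzero \<and>
     br W Y = (- z2) \<odot> W \<and>
     br Y X = (2 * z2) \<odot> X \<oplus> \<theta>1 \<odot> Z \<oplus> \<theta>2 \<odot> W"

definition family8 :: "real \<Rightarrow> real \<Rightarrow> real \<Rightarrow> real \<Rightarrow> real \<Rightarrow> real \<Rightarrow> 'a frame_predicate" where
  "family8 z2 z4 w2 r \<theta>1 \<theta>2 br X Y Z W \<longleftrightarrow>
     r \<noteq> 0 \<and>
     br W Z = vzero \<and>
     br Z X = vzero \<and>
     br Z Y = z2 \<odot> Z \<oplus> w2 \<odot> W \<and>
     br W X = vzero \<and>
     br W Y = z4 \<odot> Z \<oplus> (- z2) \<odot> W \<and>
     br Y X = r \<odot> X \<oplus> \<theta>1 \<odot> Z \<oplus> \<theta>2 \<odot> W"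

definition family9 :: "real \<Rightarrow> real \<Rightarrow> real \<Rightarrow> real \<Rightarrow> real \<Rightarrow> 'a frame_predicate" where
  "family9 z2 z3 z4 \<theta>1 \<theta>2 br X Y Z W \<longleftrightarrow>
     z2 \<noteq> 0 \<and> z3 \<noteq> 0 \<and>
     br W Z = vzero \<and>
     br Z X = vzero \<and>
     br Z Y = z2 \<odot> Z \<and>
     br W X = z3 \<odot> Z \<and>
     br W Y = z4 \<odot> Z \<oplus> (- z2) \<odot> W \<and>
     br Y X = (- 2 * z2) \<odot> X \<oplus> \<theta>1 \<odot> Z \<oplus> \<theta>2 \<odot> W"

definition family10 :: "real \<Rightarrow> real \<Rightarrow> real \<Rightarrow> real \<Rightarrow> 'a frame_predicate" where
  "family10 \<alpha> a \<beta> b br X Y Z W \<longleftrightarrow>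
     \<alpha> * b - a * \<beta> \<noteq> 0 \<and>
     br W Z = vzero \<and>
     br Z X = \<alpha> \<odot> X \<oplus> \<beta> \<odot> Y \<and>
     br Z Y = (- \<beta>) \<odot> X \<oplus> \<alpha> \<odot> Y \<and>
     br W X = a \<odot> X \<oplus> b \<odot> Y \<and>
     br W Y = (- b) \<odot> X \<oplus> a \<odot> Y \<and>
     br Y X = vzero"

definition family11 :: "real \<Rightarrow> real \<Rightarrow> real \<Rightarrow> real \<Rightarrow> real \<Rightarrow> real \<Rightarrow> 'a frame_predicate" where
  "family11 z1 z2 z3 w1 \<theta>1 \<theta>2 br X Y Z W \<longleftrightarrow>
     z1 \<noteq> 0 \<and>
     br W Z = vzero \<and>
     br Z X = z1 \<odot> Z \<oplus> w1 \<odot> W \<and>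
     br Z Y = z2 \<odot> Z \<oplus> (z2 * w1 / z1) \<odot> W \<and>
     br W X = z3 \<odot> Z \<oplus> (- z1) \<odot> W \<and>
     br W Y = (z2 * z3 / z1) \<odot> Z \<oplus> (- z2) \<odot> W \<and>
     br Y X = \<theta>1 \<odot> Z \<oplus> \<theta>2 \<odot> W"

definition family12 :: "real \<Rightarrow> real \<Rightarrow> real \<Rightarrow> real \<Rightarrow> real \<Rightarrow> 'a frame_predicate" where
  "family12 z3 w1 w2 \<theta>1 \<theta>2 br X Y Z W \<longleftrightarrow>
     w1 \<noteq> 0 \<and>
     br W Z = vzero \<and>
     br Z X = w1 \<odot> W \<and>
     br Z Y = w2 \<odot> W \<and>
     br W X = z3 \<odot> Z \<and>
     br W Y = (z3 * w2 / w1) \<odot> Z \<and>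
     br Y X = \<theta>1 \<odot> Z \<oplus> \<theta>2 \<odot> W"

definition family13 :: "real \<Rightarrow> real \<Rightarrow> real \<Rightarrow> real \<Rightarrow> 'a frame_predicate" where
  "family13 z3 z4 \<theta>1 \<theta>2 br X Y Z W \<longleftrightarrow>
     z3 \<noteq> 0 \<and>
     br W Z = vzero \<and>
     br Z X = vzero \<and>
     br Z Y = vzero \<and>
     br W X = z3 \<odot> Z \<and>
     br W Y = z4 \<odot> Z \<and>
     br Y X = \<theta>1 \<odot> Z \<oplus> \<theta>2 \<odot> W"

definition family14 :: "real \<Rightarrow> real \<Rightarrow> real \<Rightarrow> real \<Rightarrow> real \<Rightarrow> 'a frame_predicate" where
  "family14 z2 z4 w2 \<theta>1 \<theta>2 br X Y Z W \<longleftrightarrow>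
     br W Z = vzero \<and>
     br Z X = vzero \<and>
     br Z Y = z2 \<odot> Z \<oplus> w2 \<odot> W \<and>
     br W X = vzero \<and>
     br W Y = z4 \<odot> Z \<oplus> (- z2) \<odot> W \<and>
     br Y X = \<theta>1 \<odot> Z \<oplus> \<theta>2 \<odot> W"

definition family15 :: "real \<Rightarrow> real \<Rightarrow> real \<Rightarrow> 'a frame_predicate" where
  "family15 \<alpha> w1 w2 br X Y Z W \<longleftrightarrow>
     \<alpha> \<noteq> 0 \<and>
     br W Z = vzero \<and>
     br Z X = \<alpha> \<odot> X \<oplus> w1 \<odot> W \<and>
     br Z Y = \<alpha> \<odot> Y \<oplus> w2 \<odot> W \<and>
     br W X = vzero \<and>
     br W Y = vzero \<and>
     br Y X = vzero"

definition family16 :: "real \<Rightarrow> real \<Rightarrow> real \<Rightarrow> real \<Rightarrow> real \<Rightarrow> 'a frame_predicate" where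
  "family16 \<beta> w1 w2 \<theta>1 \<theta>2 br X Y Z W \<longleftrightarrow>
     \<beta> \<noteq> 0 \<and>
     br W Z = vzero \<and>
     br Z X = \<beta> \<odot> Y \<oplus> w1 \<odot> W \<and>
     br Z Y = (- \<beta>) \<odot> X \<oplus> w2 \<odot> W \<and>
     br W X = vzero \<and>
     br W Y = vzero \<and>
     br Y X = \<theta>1 \<odot> Z \<oplus> \<theta>2 \<odot> W"

definition family17 :: "real \<Rightarrow> real \<Rightarrow> real \<Rightarrow> real \<Rightarrow> 'a frame_predicate" where
  "family17 \<alpha> a w1 w2 br X Y Z W \<longleftrightarrow>
     \<alpha> \<noteq> 0 \<and> a \<noteq> 0 \<and>
     br W Z = vzero \<and>
     br Z X = \<alpha> \<odot> X \<oplus> (- (a * w1 / \<alpha>)) \<odot> Z \<oplus> w1 \<odot> W \<and>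
     br Z Y = \<alpha> \<odot> Y \<oplus> (- (a * w2 / \<alpha>)) \<odot> Z \<oplus> w2 \<odot> W \<and>
     br W X = a \<odot> X
         \<oplus> (- (a^2 * w1 / \<alpha>^2)) \<odot> Z
         \<oplus> (a * w1 / \<alpha>) \<odot> W \<and>
     br W Y = a \<odot> Y
         \<oplus> (- (a^2 * w2 / \<alpha>^2)) \<odot> Z
         \<oplus> (a * w2 / \<alpha>) \<odot> W \<and>
     br Y X = vzero"

definition family18 :: "real \<Rightarrow> real \<Rightarrow> real \<Rightarrow> real \<Rightarrow> real \<Rightarrow> real \<Rightarrow> 'a frame_predicate" where
  "family18 \<beta> b z3 z4 \<theta>1 \<theta>2 br X Y Z W \<longleftrightarrow>
     \<beta> \<noteq> 0 \<and> b \<noteq> 0 \<and>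
     br W Z = vzero \<and>
     br Z X = \<beta> \<odot> Y
         \<oplus> (\<beta> * z3 / b) \<odot> Z
         \<oplus> (- (\<beta>^2 * z3 / b^2)) \<odot> W \<and>
     br Z Y = (- \<beta>) \<odot> X
         \<oplus> (\<beta> * z4 / b) \<odot> Z
         \<oplus> (- (\<beta>^2 * z4 / b^2)) \<odot> W \<and>
     br W X = b \<odot> Y \<oplus> z3 \<odot> Z \<oplus> (- (\<beta> * z3 / b)) \<odot> W \<and>
     br W Y = (- b) \<odot> X \<oplus> z4 \<odot> Z \<oplus> (- (\<beta> * z4 / b)) \<odot> W \<and>
     br Y X = \<theta>1 \<odot> Z \<oplus> \<theta>2 \<odot> W"

definition family19 :: "real \<Rightarrow> real \<Rightarrow> real \<Rightarrow> real \<Rightarrow> 'a frame_predicate" where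
  "family19 \<alpha> \<beta> w1 w2 br X Y Z W \<longleftrightarrow>
     \<alpha> \<noteq> 0 \<and> \<beta> \<noteq> 0 \<and>
     br W Z = vzero \<and>
     br Z X = \<alpha> \<odot> X \<oplus> \<beta> \<odot> Y \<oplus> w1 \<odot> W \<and>
     br Z Y = (- \<beta>) \<odot> X \<oplus> \<alpha> \<odot> Y \<oplus> w2 \<odot> W \<and>
     br W X = vzero \<and>
     br W Y = vzero \<and>
     br Y X = vzero"

definition family20 :: "real \<Rightarrow> real \<Rightarrow> real \<Rightarrow> real \<Rightarrow> real \<Rightarrow> 'a frame_predicate" where
  "family20 \<alpha> a \<beta> w1 w2 br X Y Z W \<longleftrightarrow>
     \<alpha> \<noteq> 0 \<and> a \<noteq> 0 \<and> \<beta> \<noteq> 0 \<and>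
     br W Z = vzero \<and>
     br Z X = \<alpha> \<odot> X \<oplus> \<beta> \<odot> Y \<oplus> (- (a * w1 / \<alpha>)) \<odot> Z \<oplus> w1 \<odot> W \<and>
     br Z Y = (- \<beta>) \<odot> X
         \<oplus> \<alpha> \<odot> Y
         \<oplus> (- (a * w2 / \<alpha>)) \<odot> Z
         \<oplus> w2 \<odot> W \<and>
     br W X = a \<odot> X
         \<oplus> (\<beta> * a / \<alpha>) \<odot> Y
         \<oplus> (- (a^2 * w1 / \<alpha>^2)) \<odot> Z
         \<oplus> (a * w1 / \<alpha>) \<odot> W \<and>
     br W Y = (- (\<beta> * a / \<alpha>)) \<odot> X
         \<oplus> a \<odot> Y
         \<oplus> (- (a^2 * w2 / \<alpha>^2)) \<odot> Z
         \<oplus> (a * w2 / \<alpha>) \<odot> W \<and>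
     br Y X = vzero"

end

theory Submission
  imports Defs
begin

text \<open>Both $d\omega$ and $N_J$ are tensors, so although they are defined through all vector fields they
  are controlled by finitely many numbers computed from the brackets of the orthonormal frame
  $X, Y, Z, W$. The coefficients of a vector field in the frame are smooth, being its inner products
  with the frame (\<open>vector_field_components\<close>); a bracket of two fields is then given by the
  structure constants plus derivatives of coefficients (\<open>bracket_field\<close>), and these derivatives
  cancel in $d\omega(U,V,H)$ and in $N_J(U,V)$. What is left is explicit.

  A 3-form in dimension 4 has four components, and the components of $d\omega$ on triples of frame
  fields are linear in the structure constants (\<open>ext_deriv2_field\<close>). The Nijenhuis tensor is
  alternating and antilinear with respect to $J$ in each argument, so in complex dimension 2 it is determined by the single
  vector $N_J(X,Z)$ (\<open>nijenhuis_field\<close>), which again is linear in the structure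
  constants. Hence each of the two properties is a system of four linear equations in the
  structure constants (\<open>structure_constant_criteria\<close>).

  Reading off the structure constants of a family turns the claim into elementary real algebra.
  The impossible cases would need a nontrivial sum of squares, a nonzero parameter or a nonzero
  determinant to vanish.\<close>

section \<open>Smooth functions\<close>

lemma differentiable_cong_open:
  assumes "open S" "x \<in> S" "\<And>y. y \<in> S \<Longrightarrow> f y = h y"
  shows "f differentiable (at x) \<longleftrightarrow> h differentiable (at x)"
    and "frechet_derivative f (at x) = frechet_derivative h (at x)"
proof -
  have "(f has_derivative D) (at x) \<longleftrightarrow> (h has_derivative D) (at x)" for D
    using assms by (auto intro: has_derivative_transform_within_open)
  then show "f differentiable (at x) \<longleftrightarrow> h differentiable (at x)"
    and "frechet_derivative f (at x) = frechet_derivative h (at x)"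
    by (auto simp: differentiable_def frechet_derivative_def)
qed

text \<open>Openness of the set is what makes derivatives depend only on the values there; this allows the
  induction over the order of differentiability in the closure properties below, where the
  derivative of a sum or product is known only on the set.\<close>

lemma Ck_on_cong:
  assumes "open S" "\<And>y. y \<in> S \<Longrightarrow> f y = h y"
  shows "Ck_on k f S \<longleftrightarrow> Ck_on k h S"
  using assms(2)
proof (induction k arbitrary: f h)
  case 0
  then have "continuous_on S f \<longleftrightarrow> continuous_on S h"
    by (rule continuous_on_cong[OF refl])
  then show ?case by simp
next
  case (Suc k)
  have "Ck_on k (\<lambda>x. frechet_derivative f (at x) v) S \<longleftrightarrow>
        Ck_on k (\<lambda>x. frechet_derivative h (at x) v) S" for v
    by (rule Suc.IH) (simp add: differentiable_cong_open(2)[OF assms(1) _ Suc.prems])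
  then show ?case
    using differentiable_cong_open(1)[OF assms(1) _ Suc.prems]
    by (simp cong: ball_cong)
qed

text \<open>The product rule for a derivative of order \<open>k + 1\<close> leaves the undifferentiated factors, which
  the induction for products needs at order \<open>k\<close>.\<close>

lemma Ck_on_Suc_imp: "Ck_on (Suc k) f S \<Longrightarrow> Ck_on k f S"
proof (induction k arbitrary: f)
  case 0
  then have "f differentiable_on S"
    by (auto simp: differentiable_on_def intro: differentiable_at_withinI)
  then show ?case by (simp add: differentiable_imp_continuous_on)
qed auto

lemma Ck_on_const: "Ck_on k (\<lambda>x. c) S"
  by (induction k arbitrary: c) auto

lemma frechet_derivative_add:
  assumes "f differentiable (at x)" "h differentiable (at x)"
  shows "frechet_derivative (\<lambda>x. f x + h x) (at x) v =
         frechet_derivative f (at x) v + frechet_derivative h (at x) v"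
proof -
  have "((\<lambda>x. f x + h x) has_derivative
      (\<lambda>v. frechet_derivative f (at x) v + frechet_derivative h (at x) v)) (at x)"
    using assms by (intro has_derivative_add) (auto simp: frechet_derivative_works)
  then show ?thesis by (simp add: frechet_derivative_at[symmetric])
qed

lemma Ck_on_add:
  fixes f h :: "'a::real_normed_vector \<Rightarrow> 'b::real_normed_vector"
  assumes "open S" "Ck_on k f S" "Ck_on k h S"
  shows "Ck_on k (\<lambda>x. f x + h x) S"
  using assms(2,3)
proof (induction k arbitrary: f h)
  case 0
  then show ?case by (auto intro: continuous_on_add)
next
  case (Suc k)
  have "Ck_on k (\<lambda>x. frechet_derivative (\<lambda>x. f x + h x) (at x) v) S" for v
  proof -
    have "Ck_on k (\<lambda>x. frechet_derivative f (at x) v + frechet_derivative h (at x) v) S"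
      using Suc.prems by (intro Suc.IH) auto
    then show ?thesis
      by (rule Ck_on_cong[OF assms(1), THEN iffD1, rotated])
        (use Suc.prems in \<open>simp add: frechet_derivative_add\<close>)
  qed
  moreover have "\<forall>x\<in>S. (\<lambda>x. f x + h x) differentiable (at x)"
    using Suc.prems by (simp add: differentiable_add)
  ultimately show ?case by simp
qed

lemma frechet_derivative_mult:
  fixes f h :: "'a::real_normed_vector \<Rightarrow> real"
  assumes "f differentiable (at x)" "h differentiable (at x)"
  shows "frechet_derivative (\<lambda>x. f x * h x) (at x) v =
         f x * frechet_derivative h (at x) v + frechet_derivative f (at x) v * h x"
proof -
  have "((\<lambda>x. f x * h x) has_derivative
      (\<lambda>v. f x * frechet_derivative h (at x) v + frechet_derivative f (at x) v * h x)) (at x)"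
    using assms by (intro has_derivative_mult) (auto simp: frechet_derivative_works)
  then show ?thesis by (simp add: frechet_derivative_at[symmetric])
qed

lemma Ck_on_mult:
  fixes f h :: "'a::real_normed_vector \<Rightarrow> real"
  assumes "open S" "Ck_on k f S" "Ck_on k h S"
  shows "Ck_on k (\<lambda>x. f x * h x) S"
  using assms(2,3)
proof (induction k arbitrary: f h)
  case 0
  then show ?case by (auto intro: continuous_on_mult)
next
  case (Suc k)
  have "Ck_on k (\<lambda>x. frechet_derivative (\<lambda>x. f x * h x) (at x) v) S" for v
  proof -
    have "Ck_on k (\<lambda>x. f x * frechet_derivative h (at x) v
                     + frechet_derivative f (at x) v * h x) S"
      using Suc.prems Ck_on_Suc_imp by (intro Ck_on_add[OF assms(1)] Suc.IH) auto
    then show ?thesis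
      by (rule Ck_on_cong[OF assms(1), THEN iffD1, rotated])
        (use Suc.prems in \<open>simp add: frechet_derivative_mult\<close>)
  qed
  moreover have "\<forall>x\<in>S. (\<lambda>x. f x * h x) differentiable (at x)"
    using Suc.prems by (simp add: differentiable_mult)
  ultimately show ?case by simp
qed

lemma smooth_atlasD:
  assumes "smooth_atlas A" "(U, \<phi>) \<in> A"
  shows "open U" "open (\<phi> ` U)" "homeomorphism U (\<phi> ` U) \<phi> (inv_into U \<phi>)"
proof -
  have "\<forall>(U, \<phi>)\<in>A. open U \<and> open (\<phi> ` U) \<and> homeomorphism U (\<phi> ` U) \<phi> (inv_into U \<phi>)"
    using assms(1) unfolding smooth_atlas_def by (elim conjE)
  from bspec[OF this assms(2)]
  show "open U" "open (\<phi> ` U)" "homeomorphism U (\<phi> ` U) \<phi> (inv_into U \<phi>)"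
    by simp_all
qed

lemma chart_inverse:
  assumes "smooth_atlas A" "(U, \<phi>) \<in> A" "p \<in> U"
  shows "inv_into U \<phi> (\<phi> p) = p"
  using smooth_atlasD(3)[OF assms(1,2)] assms(3) by (simp add: homeomorphism_def)

lemma smooth_fun_const: "smooth_fun A (\<lambda>x. c)"
  by (auto simp: smooth_fun_def Cinf_on_def comp_def Ck_on_const)

lemma smooth_fun_add:
  assumes "smooth_atlas A" "smooth_fun A f" "smooth_fun A h"
  shows "smooth_fun A (\<lambda>x. f x + h x)"
  unfolding smooth_fun_def Cinf_on_def comp_def
proof clarify
  fix U \<phi> k
  assume U: "(U, \<phi>) \<in> A"
  then have "Ck_on k (\<lambda>x. f (inv_into U \<phi> x)) (\<phi> ` U)" "Ck_on k (\<lambda>x. h (inv_into U \<phi> x)) (\<phi> ` U)"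
    using assms(2,3) by (auto simp: smooth_fun_def Cinf_on_def comp_def)
  then show "Ck_on k (\<lambda>x. f (inv_into U \<phi> x) + h (inv_into U \<phi> x)) (\<phi> ` U)"
    by (rule Ck_on_add[OF smooth_atlasD(2)[OF assms(1) U]])
qed

lemma smooth_fun_mult:
  assumes "smooth_atlas A" "smooth_fun A f" "smooth_fun A h"
  shows "smooth_fun A (\<lambda>x. f x * h x)"
  unfolding smooth_fun_def Cinf_on_def comp_def
proof clarify
  fix U \<phi> k
  assume U: "(U, \<phi>) \<in> A"
  then have "Ck_on k (\<lambda>x. f (inv_into U \<phi> x)) (\<phi> ` U)" "Ck_on k (\<lambda>x. h (inv_into U \<phi> x)) (\<phi> ` U)"
    using assms(2,3) by (auto simp: smooth_fun_def Cinf_on_def comp_def)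
  then show "Ck_on k (\<lambda>x. f (inv_into U \<phi> x) * h (inv_into U \<phi> x)) (\<phi> ` U)"
    by (rule Ck_on_mult[OF smooth_atlasD(2)[OF assms(1) U]])
qed

lemma smooth_fun_uminus:
  assumes "smooth_atlas A" "smooth_fun A f"
  shows "smooth_fun A (\<lambda>x. - f x)"
  using smooth_fun_mult[OF assms(1) smooth_fun_const[of A "-1"] assms(2)] by simp

lemma smooth_fun_diff:
  assumes "smooth_atlas A" "smooth_fun A f" "smooth_fun A h"
  shows "smooth_fun A (\<lambda>x. f x - h x)"
  using smooth_fun_add[OF assms(1,2) smooth_fun_uminus[OF assms(1,3)]] by simp

lemma smooth_fun_chart_differentiable:
  assumes "smooth_fun A f" "(U, \<phi>) \<in> A" "p \<in> U"
  shows "(f \<circ> inv_into U \<phi>) differentiable (at (\<phi> p))"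
proof -
  have "Ck_on (Suc 0) (f \<circ> inv_into U \<phi>) (\<phi> ` U)"
    using assms by (auto simp: smooth_fun_def Cinf_on_def simp del: Ck_on.simps)
  then show ?thesis using assms(3) by auto
qed

section \<open>Tangent vectors are derivations\<close>

text \<open>The tangent vector with coordinates \<open>\<xi>\<close> in one fixed chart. Fixing the chart makes the
  tangent space a linear image of $\mathbf R^4$.\<close>

definition chart_vector :: "'a atlas \<Rightarrow> 'a set \<Rightarrow> ('a \<Rightarrow> real^4) \<Rightarrow> 'a \<Rightarrow> real^4 \<Rightarrow> 'a tangent" where
  "chart_vector A U \<phi> p \<xi> = (\<lambda>f.
     if smooth_fun A f then frechet_derivative (f \<circ> inv_into U \<phi>) (at (\<phi> p)) \<xi> else 0)"

lemma chart_vector_linear: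
  assumes "(U, \<phi>) \<in> A" "p \<in> U"
  shows "chart_vector A U \<phi> p (a *\<^sub>R \<xi> + b *\<^sub>R \<eta>) =
         (\<lambda>f. a * chart_vector A U \<phi> p \<xi> f + b * chart_vector A U \<phi> p \<eta> f)"
proof -
  have "linear (frechet_derivative (f \<circ> inv_into U \<phi>) (at (\<phi> p)))" if "smooth_fun A f" for f
    using smooth_fun_chart_differentiable[OF that assms] by (rule linear_frechet_derivative)
  then show ?thesis
    by (auto simp: chart_vector_def fun_eq_iff linear_add linear_scale)
qed

text \<open>By the chain rule the new coordinates are the image of the old ones under the derivative of the
  transition map, and this image does not depend on the test function.\<close>

lemma chart_vector_change:
  assumes A: "smooth_atlas A" and U: "(U, \<phi>) \<in> A" "p \<in> U" and V: "(V, \<psi>) \<in> A" "p \<in> V"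
  shows "\<exists>\<eta>. chart_vector A U \<phi> p \<xi> = chart_vector A V \<psi> p \<eta>"
proof -
  let ?t = "\<psi> \<circ> inv_into U \<phi>"
  let ?D = "frechet_derivative ?t (at (\<phi> p))"
  have "open (\<phi> ` (U \<inter> V))"
  proof -
    have "openin (top_of_set (\<phi> ` U)) (\<phi> ` (U \<inter> V))"
      using smooth_atlasD[OF A U(1)] smooth_atlasD(1)[OF A V(1)]
      by (intro homeomorphism_imp_open_map) auto
    then show ?thesis using smooth_atlasD(2)[OF A U(1)] openin_open_trans by blast
  qed
  moreover have "\<phi> p \<in> \<phi> ` (U \<inter> V)" using U V by auto
  moreover have "Ck_on (Suc 0) ?t (\<phi> ` (U \<inter> V))"
    using A U V unfolding smooth_atlas_def Cinf_on_def by fast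
  ultimately have t: "(?t has_derivative ?D) (at (\<phi> p))"
    by (auto simp: frechet_derivative_works[symmetric])
  have tp: "?t (\<phi> p) = \<psi> p" using chart_inverse[OF A U] by simp
  have "chart_vector A U \<phi> p \<xi> f = chart_vector A V \<psi> p (?D \<xi>) f" for f
  proof (cases "smooth_fun A f")
    case True
    let ?F = "f \<circ> inv_into V \<psi>"
    have "(?F has_derivative frechet_derivative ?F (at (\<psi> p))) (at (?t (\<phi> p)))"
      using smooth_fun_chart_differentiable[OF True V] unfolding tp
      by (simp add: frechet_derivative_works)
    then have "((\<lambda>x. ?F (?t x)) has_derivative (\<lambda>x. frechet_derivative ?F (at (\<psi> p)) (?D x))) (at (\<phi> p))"
      using t by (rule has_derivative_compose[rotated])
    then have "((f \<circ> inv_into U \<phi>) has_derivative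
        (\<lambda>x. frechet_derivative ?F (at (\<psi> p)) (?D x))) (at (\<phi> p))"
    proof (rule has_derivative_transform_within_open)
      show "open (\<phi> ` (U \<inter> V))" "\<phi> p \<in> \<phi> ` (U \<inter> V)" by fact+
    qed (auto simp: chart_inverse[OF A U(1)] chart_inverse[OF A V(1)])
    then have "frechet_derivative (f \<circ> inv_into U \<phi>) (at (\<phi> p)) =
        (\<lambda>x. frechet_derivative ?F (at (\<psi> p)) (?D x))"
      by (rule frechet_derivative_at[symmetric])
    then show ?thesis using True by (simp add: chart_vector_def)
  qed (simp add: chart_vector_def)
  then show ?thesis by blast
qed

lemma tangent_space_chart:
  assumes "smooth_atlas A" "(U, \<phi>) \<in> A" "p \<in> U"
  shows "tangent_space A p = range (chart_vector A U \<phi> p)"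
proof -
  have "tangent_space A p = {v. \<exists>(V, \<psi>)\<in>A. p \<in> V \<and> (\<exists>\<xi>. v = chart_vector A V \<psi> p \<xi>)}"
    by (simp add: tangent_space_def chart_vector_def)
  also have "\<dots> = range (chart_vector A U \<phi> p)"
    using assms(2,3) chart_vector_change[OF assms(1) _ _ assms(2,3)] by (auto; blast)
  finally show ?thesis .
qed

lemma chart_at:
  assumes "smooth_atlas A"
  obtains U \<phi> where "(U, \<phi>) \<in> A" "p \<in> U"
proof -
  have "p \<in> (\<Union>(U, \<phi>)\<in>A. U)"
    using assms unfolding smooth_atlas_def by (elim conjE) simp
  then show thesis using that by blast
qed

lemma tangent_space_lincomb:
  assumes A: "smooth_atlas A" and "u \<in> tangent_space A p" "v \<in> tangent_space A p"
  shows "(\<lambda>f. a * u f + b * v f) \<in> tangent_space A p"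
proof -
  obtain U \<phi> where U: "(U, \<phi>) \<in> A" "p \<in> U" using chart_at[OF A] .
  then obtain \<xi> \<eta> where "u = chart_vector A U \<phi> p \<xi>" "v = chart_vector A U \<phi> p \<eta>"
    using assms(2,3) unfolding tangent_space_chart[OF A U] by blast
  then have "(\<lambda>f. a * u f + b * v f) = chart_vector A U \<phi> p (a *\<^sub>R \<xi> + b *\<^sub>R \<eta>)"
    by (simp add: chart_vector_linear[OF U])
  then show ?thesis unfolding tangent_space_chart[OF A U] by blast
qed

lemma tangent_chart_vector:
  assumes "smooth_atlas A" "v \<in> tangent_space A p"
  obtains U \<phi> \<xi> where "(U, \<phi>) \<in> A" "p \<in> U" "v = chart_vector A U \<phi> p \<xi>"
proof -
  obtain U \<phi> where U: "(U, \<phi>) \<in> A" "p \<in> U" using chart_at[OF assms(1)] .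
  have "v \<in> range (chart_vector A U \<phi> p)"
    using assms(2) unfolding tangent_space_chart[OF assms(1) U] .
  then obtain \<xi> where "v = chart_vector A U \<phi> p \<xi>" by (rule rangeE)
  with U show thesis by (rule that)
qed

lemma tangent_nonsmooth:
  assumes "smooth_atlas A" "v \<in> tangent_space A p" "\<not> smooth_fun A f"
  shows "v f = 0"
proof -
  obtain U \<phi> \<xi> where "(U, \<phi>) \<in> A" "p \<in> U" "v = chart_vector A U \<phi> p \<xi>"
    using tangent_chart_vector[OF assms(1,2)] .
  with assms(3) show ?thesis by (simp add: chart_vector_def)
qed

lemma tangent_const:
  assumes "smooth_atlas A" "v \<in> tangent_space A p"
  shows "v (\<lambda>x. c) = 0"
proof -
  obtain U \<phi> \<xi> where "(U, \<phi>) \<in> A" "p \<in> U" "v = chart_vector A U \<phi> p \<xi>"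
    using tangent_chart_vector[OF assms] .
  then have "v (\<lambda>x. c) = frechet_derivative ((\<lambda>x. c) \<circ> inv_into U \<phi>) (at (\<phi> p)) \<xi>"
    by (simp add: chart_vector_def smooth_fun_const)
  also have "(\<lambda>x. c) \<circ> inv_into U \<phi> = (\<lambda>x. c)"
    by (rule ext) simp
  finally show ?thesis by simp
qed

lemma tangent_add:
  assumes A: "smooth_atlas A" "v \<in> tangent_space A p" and f: "smooth_fun A f" "smooth_fun A h"
  shows "v (\<lambda>x. f x + h x) = v f + v h"
proof -
  obtain U \<phi> \<xi> where U: "(U, \<phi>) \<in> A" "p \<in> U" and v: "v = chart_vector A U \<phi> p \<xi>"
    using tangent_chart_vector[OF A] .
  have "(\<lambda>x. f x + h x) \<circ> inv_into U \<phi> = (\<lambda>x. (f \<circ> inv_into U \<phi>) x + (h \<circ> inv_into U \<phi>) x)"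
    by (rule ext) simp
  then show ?thesis
    using f smooth_fun_add[OF A(1) f]
      frechet_derivative_add[OF f[THEN smooth_fun_chart_differentiable, OF U]]
    by (simp add: v chart_vector_def)
qed

lemma tangent_mult:
  assumes A: "smooth_atlas A" "v \<in> tangent_space A p" and f: "smooth_fun A f" "smooth_fun A h"
  shows "v (\<lambda>x. f x * h x) = f p * v h + v f * h p"
proof -
  obtain U \<phi> \<xi> where U: "(U, \<phi>) \<in> A" "p \<in> U" and v: "v = chart_vector A U \<phi> p \<xi>"
    using tangent_chart_vector[OF A] .
  have "(\<lambda>x. f x * h x) \<circ> inv_into U \<phi> = (\<lambda>x. (f \<circ> inv_into U \<phi>) x * (h \<circ> inv_into U \<phi>) x)"
    by (rule ext) simp
  then show ?thesis
    using f smooth_fun_mult[OF A(1) f] chart_inverse[OF A(1) U]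
      frechet_derivative_mult[OF f[THEN smooth_fun_chart_differentiable, OF U]]
    by (simp add: v chart_vector_def)
qed

lemma tangent_uminus:
  assumes "smooth_atlas A" "v \<in> tangent_space A p" "smooth_fun A f"
  shows "v (\<lambda>x. - f x) = - v f"
  using tangent_mult[OF assms(1,2) smooth_fun_const[of A "-1"] assms(3)] tangent_const[OF assms(1,2)]
  by simp

lemma tangent_diff:
  assumes "smooth_atlas A" "v \<in> tangent_space A p" "smooth_fun A f" "smooth_fun A h"
  shows "v (\<lambda>x. f x - h x) = v f - v h"
  using tangent_add[OF assms(1,2,3) smooth_fun_uminus[OF assms(1,4)]]
    tangent_uminus[OF assms(1,2,4)] by simp

section \<open>Unitary frames\<close>

locale unitary_frame =
  fixes A :: "'a::{t2_space, second_countable_topology} atlas"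
    and g :: "'a tensor2" and J :: "'a endo" and X Y Z W :: "'a vfield"
  assumes atlas: "smooth_atlas A"
    and metric: "riemannian_metric A g"
    and acs: "almost_complex A J"
    and fields: "X \<in> vector_fields A" "Y \<in> vector_fields A" "Z \<in> vector_fields A" "W \<in> vector_fields A"
    and orthonormal:
      "\<forall>i<4. \<forall>j<4. \<forall>p. g p (([X, Y, Z, W] ! i) p) (([X, Y, Z, W] ! j) p) = (if i = j then 1 else 0)"
    and J_frame: "apply_endo J X = Y" "apply_endo J Y = (-1) \<odot> X"
      "apply_endo J Z = W" "apply_endo J W = (-1) \<odot> Z"
begin

text \<open>Coordinates with respect to the frame are functions on \<open>nat\<close> of which only the values at
  0, 1, 2, 3 (for $X, Y, Z, W$) are read.\<close>

definition comb :: "'a \<Rightarrow> (nat \<Rightarrow> real) \<Rightarrow> 'a tangent" where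
  "comb p a = (\<lambda>f. a 0 * X p f + a 1 * Y p f + a 2 * Z p f + a 3 * W p f)"

definition field :: "(nat \<Rightarrow> 'a \<Rightarrow> real) \<Rightarrow> 'a vfield" where
  "field u = (\<lambda>p. comb p (\<lambda>i. u i p))"

text \<open>The matrix of $J$ in the frame; identifying the coordinates with
  $(a_0 + i a_1, a_2 + i a_3)$ it is multiplication by $i$.\<close>

definition rot :: "(nat \<Rightarrow> real) \<Rightarrow> nat \<Rightarrow> real" where
  "rot a i = (if i = 0 then - a 1 else if i = 1 then a 0 else if i = 2 then - a 3 else a 2)"

lemma frame_tangent:
  "X p \<in> tangent_space A p" "Y p \<in> tangent_space A p"
  "Z p \<in> tangent_space A p" "W p \<in> tangent_space A p"
  using fields by (simp_all add: vector_fields_def)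

lemma frame_smooth:
  assumes "smooth_fun A f"
  shows "smooth_fun A (\<lambda>q. X q f)" "smooth_fun A (\<lambda>q. Y q f)"
    "smooth_fun A (\<lambda>q. Z q f)" "smooth_fun A (\<lambda>q. W q f)"
  using fields assms by (simp_all add: vector_fields_def)

text \<open>The linearity axioms of the metric and of $J$ speak of combinations of two vectors only, so a
  combination of four has to be bracketed in pairs.\<close>

lemma comb_pairs:
  "comb p a = (\<lambda>f. 1 * (\<lambda>f. a 0 * X p f + a 1 * Y p f) f + 1 * (\<lambda>f. a 2 * Z p f + a 3 * W p f) f)"
  by (simp add: comb_def add.assoc)

lemma comb_tangent: "comb p a \<in> tangent_space A p"
  unfolding comb_pairs by (intro tangent_space_lincomb[OF atlas] frame_tangent)

lemma comb_cong:
  assumes "a 0 = b 0" "a 1 = b 1" "a 2 = b 2" "a 3 = b 3"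
  shows "comb p a = comb p b"
  using assms by (simp add: comb_def)

lemma comb_add: "comb p a f + comb p b f = comb p (\<lambda>i. a i + b i) f"
  by (simp add: comb_def algebra_simps)

lemma comb_scale: "c * comb p a f = comb p (\<lambda>i. c * a i) f"
  by (simp add: comb_def algebra_simps)

lemma metric_sym:
  assumes "u \<in> tangent_space A p" "v \<in> tangent_space A p"
  shows "g p u v = g p v u"
  using metric assms unfolding riemannian_metric_def by (elim conjE) simp

lemma metric_lincomb:
  assumes "u \<in> tangent_space A p" "v \<in> tangent_space A p" "w \<in> tangent_space A p"
  shows "g p (\<lambda>f. a * u f + b * v f) w = a * g p u w + b * g p v w"
  using metric assms unfolding riemannian_metric_def by (elim conjE) simp

lemma metric_smooth:
  assumes "U \<in> vector_fields A" "V \<in> vector_fields A"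
  shows "smooth_fun A (\<lambda>p. g p (U p) (V p))"
  using metric assms unfolding riemannian_metric_def by (elim conjE) simp

lemma metric_comb_left:
  assumes "w \<in> tangent_space A p"
  shows "g p (comb p a) w = a 0 * g p (X p) w + a 1 * g p (Y p) w + a 2 * g p (Z p) w + a 3 * g p (W p) w"
  unfolding comb_pairs
  by (simp only: metric_lincomb tangent_space_lincomb[OF atlas] frame_tangent assms) simp

lemma metric_frame:
  "g p (X p) (X p) = 1" "g p (X p) (Y p) = 0" "g p (X p) (Z p) = 0" "g p (X p) (W p) = 0"
  "g p (Y p) (X p) = 0" "g p (Y p) (Y p) = 1" "g p (Y p) (Z p) = 0" "g p (Y p) (W p) = 0"
  "g p (Z p) (X p) = 0" "g p (Z p) (Y p) = 0" "g p (Z p) (Z p) = 1" "g p (Z p) (W p) = 0"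
  "g p (W p) (X p) = 0" "g p (W p) (Y p) = 0" "g p (W p) (Z p) = 0" "g p (W p) (W p) = 1"
proof -
  have o: "g p (([X, Y, Z, W] ! i) p) (([X, Y, Z, W] ! j) p) = (if i = j then 1 else 0)"
    if "i < 4" "j < 4" for i j
    using orthonormal that by blast
  show "g p (X p) (X p) = 1" using o[of 0 0] by simp
  show "g p (X p) (Y p) = 0" using o[of 0 1] by simp
  show "g p (X p) (Z p) = 0" using o[of 0 2] by simp
  show "g p (X p) (W p) = 0" using o[of 0 3] by simp
  show "g p (Y p) (X p) = 0" using o[of 1 0] by simp
  show "g p (Y p) (Y p) = 1" using o[of 1 1] by simp
  show "g p (Y p) (Z p) = 0" using o[of 1 2] by simp
  show "g p (Y p) (W p) = 0" using o[of 1 3] by simp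
  show "g p (Z p) (X p) = 0" using o[of 2 0] by simp
  show "g p (Z p) (Y p) = 0" using o[of 2 1] by simp
  show "g p (Z p) (Z p) = 1" using o[of 2 2] by simp
  show "g p (Z p) (W p) = 0" using o[of 2 3] by simp
  show "g p (W p) (X p) = 0" using o[of 3 0] by simp
  show "g p (W p) (Y p) = 0" using o[of 3 1] by simp
  show "g p (W p) (Z p) = 0" using o[of 3 2] by simp
  show "g p (W p) (W p) = 1" using o[of 3 3] by simp
qed

lemma metric_comb_frame:
  "g p (comb p a) (X p) = a 0" "g p (comb p a) (Y p) = a 1"
  "g p (comb p a) (Z p) = a 2" "g p (comb p a) (W p) = a 3"
  by (simp_all add: metric_comb_left frame_tangent metric_frame)

lemma metric_comb:
  "g p (comb p a) (comb p b) = a 0 * b 0 + a 1 * b 1 + a 2 * b 2 + a 3 * b 3"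
  by (simp add: metric_comb_left[OF comb_tangent] metric_sym[OF frame_tangent(1) comb_tangent]
      metric_sym[OF frame_tangent(2) comb_tangent] metric_sym[OF frame_tangent(3) comb_tangent]
      metric_sym[OF frame_tangent(4) comb_tangent] metric_comb_frame)

text \<open>Orthonormality gives pointwise independence, which is stronger than the independence of the
  frame fields over the reals: the coefficients are recovered as inner products.\<close>

lemma comb_eq_zero:
  assumes "comb p a = (\<lambda>f. 0)"
  shows "a 0 = 0" "a 1 = 0" "a 2 = 0" "a 3 = 0"
proof -
  have "g p (comb p a) w = 0" if "w \<in> tangent_space A p" for w
    using metric_lincomb[OF frame_tangent(1) frame_tangent(1) that, of 0 0] by (simp add: assms)
  then show "a 0 = 0" "a 1 = 0" "a 2 = 0" "a 3 = 0"
    using frame_tangent metric_comb_frame[of p a] by auto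
qed

text \<open>The tangent space is the image of $\mathbf R^4$ under a chart, and the frame consists of four
  independent vectors in it; so the map \<open>F\<close> sending frame coordinates to chart coordinates is
  injective, hence surjective.\<close>

lemma tangent_comb:
  assumes "u \<in> tangent_space A p"
  obtains a where "u = comb p a"
proof -
  obtain U \<phi> where U: "(U, \<phi>) \<in> A" "p \<in> U" using chart_at[OF atlas] .
  let ?L = "chart_vector A U \<phi> p"
  have T: "tangent_space A p = range ?L" by (rule tangent_space_chart[OF atlas U])
  obtain x y z w where xyzw: "X p = ?L x" "Y p = ?L y" "Z p = ?L z" "W p = ?L w"
    using frame_tangent[of p] unfolding T by (elim rangeE)
  define F where "F a = a $ 1 *\<^sub>R x + a $ 2 *\<^sub>R y + a $ 3 *\<^sub>R z + a $ 4 *\<^sub>R w" for a :: "real^4"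
  have linF: "linear F"
    by (rule linearI) (simp_all add: F_def algebra_simps)
  have F: "?L (F a) = comb p (\<lambda>i. [a $ 1, a $ 2, a $ 3, a $ 4] ! i)" for a
  proof -
    have "F a = 1 *\<^sub>R (a $ 1 *\<^sub>R x + a $ 2 *\<^sub>R y) + 1 *\<^sub>R (a $ 3 *\<^sub>R z + a $ 4 *\<^sub>R w)"
      by (simp add: F_def)
    then show ?thesis
      unfolding comb_pairs xyzw by (simp only: chart_vector_linear[OF U]) simp
  qed
  have "a = 0" if "F a = 0" for a
  proof -
    have "?L 0 = (\<lambda>f. 0)"
      using chart_vector_linear[OF U, of 0 0 0 0] by simp
    then have "comb p (\<lambda>i. [a $ 1, a $ 2, a $ 3, a $ 4] ! i) = (\<lambda>f. 0)"
      using F[of a] that by simp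
    from comb_eq_zero[OF this] show ?thesis by (simp add: vec_eq_iff forall_4)
  qed
  then have "inj F" using linear_injective_0[OF linF] by blast
  then have "surj F" using linear_injective_imp_surjective[OF linF] by simp
  moreover obtain \<xi> where "u = ?L \<xi>" using assms unfolding T by (elim rangeE)
  ultimately show thesis using F that by (metis surjD)
qed

lemma vector_field_components:
  assumes "V \<in> vector_fields A"
  obtains v where "\<And>i. smooth_fun A (v i)" "V = field v"
proof
  let ?E = "\<lambda>i. if i = 0 then X else if i = 1 then Y else if i = 2 then Z else W"
  let ?v = "\<lambda>i p. g p (V p) (?E i p)"
  show "smooth_fun A (?v i)" for i :: nat
    by (intro metric_smooth assms) (simp add: fields)
  show "V = field ?v"
  proof
    fix p
    have "V p \<in> tangent_space A p" using assms by (simp add: vector_fields_def)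
    then obtain a where a: "V p = comb p a" by (rule tangent_comb)
    also have "comb p a = comb p (\<lambda>i. ?v i p)"
      by (rule comb_cong) (simp_all add: a metric_comb_frame)
    finally show "V p = field ?v p" by (simp only: field_def)
  qed
qed

definition unit :: "nat \<Rightarrow> nat \<Rightarrow> 'a \<Rightarrow> real" where
  "unit j i p = (if i = j then 1 else 0)"

lemma smooth_unit: "smooth_fun A (unit j i)"
  unfolding unit_def by (rule smooth_fun_const)

lemma frame_field: "X = field (unit 0)" "Y = field (unit 1)" "Z = field (unit 2)" "W = field (unit 3)"
  by (simp_all add: field_def comb_def unit_def)

lemma J_lincomb:
  assumes "u \<in> tangent_space A p" "v \<in> tangent_space A p"
  shows "J p (\<lambda>f. a * u f + b * v f) = (\<lambda>f. a * J p u f + b * J p v f)"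
  using acs assms unfolding almost_complex_def by (elim conjE) simp

lemma J_comb: "J p (comb p a) = comb p (rot a)"
proof -
  have J: "J p (X p) = Y p" "J p (Y p) = (\<lambda>f. - X p f)" "J p (Z p) = W p" "J p (W p) = (\<lambda>f. - Z p f)"
    using J_frame[THEN fun_cong, of p] by (simp_all add: apply_endo_def vscale_def)
  have "J p (comb p a) = (\<lambda>f. 1 * (a 0 * J p (X p) f + a 1 * J p (Y p) f)
      + 1 * (a 2 * J p (Z p) f + a 3 * J p (W p) f))"
    unfolding comb_pairs by (simp only: J_lincomb tangent_space_lincomb[OF atlas] frame_tangent)
  then show ?thesis by (auto simp: J comb_def rot_def)
qed

lemma J_field: "apply_endo J (field u) = field (\<lambda>i p. rot (\<lambda>j. u j p) i)"
  by (simp add: apply_endo_def field_def J_comb)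

lemma kahler_form_comb:
  "kahler_form g J p (comb p a) (comb p b) = a 0 * b 1 - a 1 * b 0 + a 2 * b 3 - a 3 * b 2"
  by (simp add: kahler_form_def J_comb metric_comb rot_def)

end
section \<open>The exterior derivative and the Nijenhuis tensor in a frame\<close>

locale lie_frame = unitary_frame +
  fixes wz zx zy wx wy yx :: "nat \<Rightarrow> real"
  assumes brackets:
    "lie_bracket A W Z = field (\<lambda>i p. wz i)" "lie_bracket A Z X = field (\<lambda>i p. zx i)"
    "lie_bracket A Z Y = field (\<lambda>i p. zy i)" "lie_bracket A W X = field (\<lambda>i p. wx i)"
    "lie_bracket A W Y = field (\<lambda>i p. wy i)" "lie_bracket A Y X = field (\<lambda>i p. yx i)"
begin

text \<open>The Leibniz rule, separating the derivatives of the coefficients from the second derivatives of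
  the test function, which cancel in a bracket up to the brackets of the frame.\<close>

lemma field_second_derivative:
  assumes t: "t \<in> tangent_space A p" and v: "\<And>i. smooth_fun A (v i)" and f: "smooth_fun A f"
  shows "t (\<lambda>q. field v q f) = comb p (\<lambda>i. t (v i)) f +
      (v 0 p * t (\<lambda>q. X q f) + v 1 p * t (\<lambda>q. Y q f) + v 2 p * t (\<lambda>q. Z q f) + v 3 p * t (\<lambda>q. W q f))"
  unfolding field_def comb_def
  by (simp add: tangent_add[OF atlas t] tangent_mult[OF atlas t] v frame_smooth[OF f]
      smooth_fun_add[OF atlas] smooth_fun_mult[OF atlas])

lemma bracket_field:
  assumes u: "\<And>i. smooth_fun A (u i)" and v: "\<And>i. smooth_fun A (v i)"
  shows "lie_bracket A (field u) (field v) p = comb p (\<lambda>k.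
      (u 3 p * v 2 p - u 2 p * v 3 p) * wz k + (u 2 p * v 0 p - u 0 p * v 2 p) * zx k +
      (u 2 p * v 1 p - u 1 p * v 2 p) * zy k + (u 3 p * v 0 p - u 0 p * v 3 p) * wx k +
      (u 3 p * v 1 p - u 1 p * v 3 p) * wy k + (u 1 p * v 0 p - u 0 p * v 1 p) * yx k +
      (field u p (v k) - field v p (u k)))"
    (is "_ = comb p ?c")
proof
  fix f
  show "lie_bracket A (field u) (field v) p f = comb p ?c f"
    \<comment> \<open>On functions that are not smooth both sides have the value 0.\<close>
  proof (cases "smooth_fun A f")
    case False
    then show ?thesis
      using tangent_nonsmooth[OF atlas comb_tangent False] by (simp add: lie_bracket_def)
  next
    case True
    have t: "field u p \<in> tangent_space A p" for u by (simp add: field_def comb_tangent)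
    \<comment> \<open>Used as a rewrite rule, this brings the second derivatives into one fixed order.\<close>
    have br: "V p (\<lambda>q. V' q f) = V' p (\<lambda>q. V q f) + comb p w f"
      if "lie_bracket A V V' = field (\<lambda>i p. w i)" for V V' w
      using fun_cong[OF fun_cong[OF that, of p], of f] True by (simp add: lie_bracket_def field_def)
    have app: "field u p h = u 0 p * X p h + u 1 p * Y p h + u 2 p * Z p h + u 3 p * W p h" for u h
      by (simp add: field_def comb_def)
    have "lie_bracket A (field u) (field v) p f =
        field u p (\<lambda>q. field v q f) - field v p (\<lambda>q. field u q f)"
      using True by (simp add: lie_bracket_def)
    also have "\<dots> = comb p (\<lambda>i. field u p (v i)) f - comb p (\<lambda>i. field v p (u i)) f +
        ((v 0 p * field u p (\<lambda>q. X q f) + v 1 p * field u p (\<lambda>q. Y q f)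
          + v 2 p * field u p (\<lambda>q. Z q f) + v 3 p * field u p (\<lambda>q. W q f))
        - (u 0 p * field v p (\<lambda>q. X q f) + u 1 p * field v p (\<lambda>q. Y q f)
          + u 2 p * field v p (\<lambda>q. Z q f) + u 3 p * field v p (\<lambda>q. W q f)))"
      by (simp only: field_second_derivative[OF t v True] field_second_derivative[OF t u True])
    also have "\<dots> = comb p (\<lambda>i. field u p (v i)) f - comb p (\<lambda>i. field v p (u i)) f +
        ((u 3 p * v 2 p - u 2 p * v 3 p) * comb p wz f + (u 2 p * v 0 p - u 0 p * v 2 p) * comb p zx f +
         (u 2 p * v 1 p - u 1 p * v 2 p) * comb p zy f + (u 3 p * v 0 p - u 0 p * v 3 p) * comb p wx f +
         (u 3 p * v 1 p - u 1 p * v 3 p) * comb p wy f + (u 1 p * v 0 p - u 0 p * v 1 p) * comb p yx f)"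
      unfolding app[of _ "\<lambda>q. X q f"] app[of _ "\<lambda>q. Y q f"] app[of _ "\<lambda>q. Z q f"] app[of _ "\<lambda>q. W q f"]
      unfolding br[OF brackets(1)] br[OF brackets(2)] br[OF brackets(3)] br[OF brackets(4)]
        br[OF brackets(5)] br[OF brackets(6)]
      by (simp add: algebra_simps)
    also have "\<dots> = comb p ?c f"
      by (simp add: comb_def algebra_simps)
    finally show ?thesis .
  qed
qed

definition det3 :: "(nat \<Rightarrow> 'a \<Rightarrow> real) \<Rightarrow> (nat \<Rightarrow> 'a \<Rightarrow> real) \<Rightarrow> (nat \<Rightarrow> 'a \<Rightarrow> real) \<Rightarrow> nat \<Rightarrow> nat \<Rightarrow> nat \<Rightarrow> 'a \<Rightarrow> real" where
  "det3 u v h i j k p = u i p * (v j p * h k p - v k p * h j p)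
     - u j p * (v i p * h k p - v k p * h i p) + u k p * (v i p * h j p - v j p * h i p)"

lemma derivative_kahler_form:
  assumes t: "t \<in> tangent_space A p"
    and v: "\<And>i. smooth_fun A (v i)" and h: "\<And>i. smooth_fun A (h i)"
  shows "t (\<lambda>q. kahler_form g J q (field v q) (field h q)) =
      (v 0 p * t (h 1) + t (v 0) * h 1 p) - (v 1 p * t (h 0) + t (v 1) * h 0 p)
      + (v 2 p * t (h 3) + t (v 2) * h 3 p) - (v 3 p * t (h 2) + t (v 3) * h 2 p)"
  unfolding field_def kahler_form_comb
  by (simp add: tangent_add[OF atlas t] tangent_diff[OF atlas t] tangent_mult[OF atlas t] v h
      smooth_fun_add[OF atlas] smooth_fun_diff[OF atlas] smooth_fun_mult[OF atlas])

text \<open>The derivatives of the coefficients coming from the first three terms of \<open>ext_deriv2\<close> cancel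
  against those in the brackets. The four factors, signs included,
  are the values of $d\omega$ on $(X,Y,Z)$, $(X,Y,W)$, $(X,Z,W)$ and $(Y,Z,W)$.\<close>

lemma ext_deriv2_field:
  assumes u: "\<And>i. smooth_fun A (u i)" and v: "\<And>i. smooth_fun A (v i)" and h: "\<And>i. smooth_fun A (h i)"
  shows "ext_deriv2 A (kahler_form g J) (field u) (field v) (field h) p =
      - (yx 3 + zx 0 + zy 1) * det3 u v h 0 1 2 p + (yx 2 - wx 0 - wy 1) * det3 u v h 0 1 3 p
      + (zx 2 + wx 3 - wz 1) * det3 u v h 0 2 3 p + (zy 2 + wy 3 + wz 0) * det3 u v h 1 2 3 p"
proof -
  have t: "field u p \<in> tangent_space A p" for u by (simp add: field_def comb_tangent)
  have f: "field u p = comb p (\<lambda>i. u i p)" for u by (simp add: field_def)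
  show ?thesis
    unfolding ext_deriv2_def derivative_kahler_form[OF t v h] derivative_kahler_form[OF t u h]
      derivative_kahler_form[OF t u v] bracket_field[OF u v] bracket_field[OF u h] bracket_field[OF v h]
    unfolding f[of u] f[of v] f[of h] kahler_form_comb det3_def
    by (simp add: algebra_simps)
qed

lemma almost_kahler_iff:
  "almost_kahler A g J \<longleftrightarrow> yx 3 + zx 0 + zy 1 = 0 \<and> yx 2 = wx 0 + wy 1 \<and>
     zx 2 + wx 3 = wz 1 \<and> zy 2 + wy 3 + wz 0 = 0" (is "_ \<longleftrightarrow> ?R")
proof
  \<comment> \<open>One point suffices, since the values on the frame are constant; \<open>undefined\<close> is an arbitrary one.\<close>
  assume ak: "almost_kahler A g J"
  then have d: "ext_deriv2 A (kahler_form g J) U V H undefined = 0"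
    if "U \<in> vector_fields A" "V \<in> vector_fields A" "H \<in> vector_fields A" for U V H
    using that by (simp add: almost_kahler_def)
  have "ext_deriv2 A (kahler_form g J) (field (unit 0)) (field (unit 1)) (field (unit 2)) undefined
      = - (yx 3 + zx 0 + zy 1)"
    "ext_deriv2 A (kahler_form g J) (field (unit 0)) (field (unit 1)) (field (unit 3)) undefined
      = yx 2 - wx 0 - wy 1"
    "ext_deriv2 A (kahler_form g J) (field (unit 0)) (field (unit 2)) (field (unit 3)) undefined
      = zx 2 + wx 3 - wz 1"
    "ext_deriv2 A (kahler_form g J) (field (unit 1)) (field (unit 2)) (field (unit 3)) undefined
      = zy 2 + wy 3 + wz 0"
    by (simp_all add: ext_deriv2_field smooth_unit det3_def unit_def)
  note this[folded frame_field]
  then show ?R using d[OF fields(1,2,3)] d[OF fields(1,2,4)] d[OF fields(1,3,4)] d[OF fields(2,3,4)]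
    by simp
next
  assume R: ?R
  show "almost_kahler A g J"
    unfolding almost_kahler_def
  proof (intro ballI allI)
    fix U V H p
    assume "U \<in> vector_fields A" "V \<in> vector_fields A" "H \<in> vector_fields A"
    then obtain u v h where "\<And>i. smooth_fun A (u i)" "U = field u"
      "\<And>i. smooth_fun A (v i)" "V = field v" "\<And>i. smooth_fun A (h i)" "H = field h"
      by (metis vector_field_components)
    then show "ext_deriv2 A (kahler_form g J) U V H p = 0"
      using R by (simp add: ext_deriv2_field)
  qed
qed

text \<open>The coordinates of $N_J(X,Z) = [X,Z] + J[Y,Z] + J[X,W] - [Y,W]$.\<close>

definition nijenhuis_XZ :: "nat \<Rightarrow> real" where
  "nijenhuis_XZ i = wy i - zx i - rot zy i - rot wx i"

lemma smooth_rot: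
  assumes "\<And>i. smooth_fun A (u i)"
  shows "smooth_fun A (\<lambda>p. rot (\<lambda>j. u j p) i)"
  using assms
  by (cases "i = 0"; cases "i = 1"; cases "i = 2"; simp add: rot_def smooth_fun_uminus[OF atlas])

text \<open>From $N_J(JU,V) = N_J(U,JV) = -J N_J(U,V)$ and antisymmetry: writing
  $U = z_1 X + z_2 Z$ and $V = w_1 X + w_2 Z$ with complex coefficients acting through $J$, one has
  $N_J(U,V) = \overline{z_1 w_2 - z_2 w_1} N_J(X,Z)$. The two real coefficients below are the
  real and imaginary parts of that conjugate; in the proof \<open>u'\<close> and \<open>v'\<close> are the
  coefficients of $JU$ and $JV$.\<close>

lemma nijenhuis_field:
  assumes u: "\<And>i. smooth_fun A (u i)" and v: "\<And>i. smooth_fun A (v i)"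
  shows "nijenhuis A J (field u) (field v) p = comb p (\<lambda>i.
      (u 0 p * v 2 p - u 1 p * v 3 p - u 2 p * v 0 p + u 3 p * v 1 p) * nijenhuis_XZ i
      - (u 0 p * v 3 p + u 1 p * v 2 p - u 2 p * v 1 p - u 3 p * v 0 p) * rot nijenhuis_XZ i)"
proof -
  define u' where "u' i p = rot (\<lambda>j. u j p) i" for i p
  define v' where "v' i p = rot (\<lambda>j. v j p) i" for i p
  have J: "apply_endo J (field u) = field u'" "apply_endo J (field v) = field v'"
    by (simp_all add: J_field u'_def[abs_def] v'_def[abs_def])
  have s: "smooth_fun A (u' i)" "smooth_fun A (v' i)" for i
    using smooth_rot[OF u] smooth_rot[OF v] by (simp_all add: u'_def[abs_def] v'_def[abs_def])
  have t: "field w p \<in> tangent_space A p" for w by (simp add: field_def comb_tangent)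
  have minus: "field w p (\<lambda>q. - u i q) = - field w p (u i)" "field w p (\<lambda>q. - v i q) = - field w p (v i)"
    for w i using tangent_uminus[OF atlas t] u v by blast+
  have coeffs: "u' 0 p = - u 1 p" "u' 1 p = u 0 p" "u' 2 p = - u 3 p" "u' 3 p = u 2 p"
    "v' 0 p = - v 1 p" "v' 1 p = v 0 p" "v' 2 p = - v 3 p" "v' 3 p = v 2 p"
    by (simp_all add: u'_def v'_def rot_def)
  have derivs: "field w p (u' 0) = - field w p (u 1)" "field w p (u' 1) = field w p (u 0)"
    "field w p (u' 2) = - field w p (u 3)" "field w p (u' 3) = field w p (u 2)"
    "field w p (v' 0) = - field w p (v 1)" "field w p (v' 1) = field w p (v 0)"
    "field w p (v' 2) = - field w p (v 3)" "field w p (v' 3) = field w p (v 2)" for w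
    by (simp_all add: u'_def[abs_def] v'_def[abs_def] rot_def minus)
  show ?thesis
    unfolding nijenhuis_def J
    unfolding apply_endo_def vadd_def vscale_def bracket_field[OF u v] bracket_field[OF s(1) v] bracket_field[OF u s(2)] bracket_field[OF s] J_comb
      comb_add comb_scale
    by (rule comb_cong; simp add: rot_def nijenhuis_XZ_def coeffs derivs algebra_simps del: One_nat_def)
qed

lemma integrable_iff:
  "integrable_acs A J \<longleftrightarrow> wx 1 + wy 0 = zx 0 - zy 1 \<and> wy 1 - wx 0 = zx 1 + zy 0 \<and>
     wx 3 + wy 2 = zx 2 - zy 3 \<and> wy 3 - wx 2 = zx 3 + zy 2" (is "_ \<longleftrightarrow> ?R")
proof -
  have R: "?R \<longleftrightarrow> nijenhuis_XZ 0 = 0 \<and> nijenhuis_XZ 1 = 0 \<and> nijenhuis_XZ 2 = 0 \<and> nijenhuis_XZ 3 = 0"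
    by (auto simp: nijenhuis_XZ_def rot_def)
  show ?thesis
    unfolding R
  proof
    assume "integrable_acs A J"
    then have "nijenhuis A J X Z undefined = (\<lambda>f. 0)"
      using fields by (simp add: integrable_acs_def vzero_def)
    moreover have "nijenhuis A J (field (unit 0)) (field (unit 2)) undefined = comb undefined nijenhuis_XZ"
      by (simp add: nijenhuis_field smooth_unit unit_def)
    note this[folded frame_field]
    ultimately show "nijenhuis_XZ 0 = 0 \<and> nijenhuis_XZ 1 = 0 \<and> nijenhuis_XZ 2 = 0 \<and> nijenhuis_XZ 3 = 0"
      using comb_eq_zero[of undefined nijenhuis_XZ] by simp
  next
    assume nij: "nijenhuis_XZ 0 = 0 \<and> nijenhuis_XZ 1 = 0 \<and> nijenhuis_XZ 2 = 0 \<and> nijenhuis_XZ 3 = 0"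
    show "integrable_acs A J"
      unfolding integrable_acs_def
    proof (intro ballI ext)
      fix U V p f
      assume "U \<in> vector_fields A" "V \<in> vector_fields A"
      then obtain u v where "\<And>i. smooth_fun A (u i)" "U = field u"
        "\<And>i. smooth_fun A (v i)" "V = field v"
        by (metis vector_field_components)
      then show "nijenhuis A J U V p f = vzero p f"
        using nij by (simp add: nijenhuis_field comb_def rot_def vzero_def)
    qed
  qed
qed

end
section \<open>The twenty families\<close>

text \<open>The determinant of this linear system in \<open>x\<close>, \<open>y\<close> is
  $4k^2 + (1-k^2)^2 = (1+k^2)^2 > 0$. It is the integrability condition of the families 17, 18
  and 20, with $k$ the ratio between the $W$ row and the $Z$ row of the bracket table (or its
  inverse).\<close>

lemma conformal_rotation_eq_zero:
  fixes k x y :: real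
  shows "2 * k * x = (k^2 - 1) * y \<and> 2 * k * y = (1 - k^2) * x \<longleftrightarrow> x = 0 \<and> y = 0"
proof
  assume *: "2 * k * x = (k^2 - 1) * y \<and> 2 * k * y = (1 - k^2) * x"
  then have "(2 * k * x) * y = (k^2 - 1) * y * y" "(2 * k * y) * x = (1 - k^2) * x * x" by simp_all
  then have "(k^2 - 1) * (x^2 + y^2) = 0" by (simp add: algebra_simps power2_eq_square)
  moreover have "x = 0 \<and> y = 0" if "k^2 - 1 = 0"
  proof -
    have "k \<noteq> 0" using that by auto
    moreover have "2 * k * x = 0" "2 * k * y = 0" using * that by simp_all
    ultimately show ?thesis by simp
  qed
  ultimately show "x = 0 \<and> y = 0" by (auto simp: sum_power2_eq_zero_iff)
qed simp

context unitary_frame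
begin

text \<open>Fields with constant coefficients, in the form in which the bracket tables are written; the rules
  below collect any right-hand side of a table into this normal form, from which the simplifier
  reads off the structure constants.\<close>

definition lincomb :: "real \<Rightarrow> real \<Rightarrow> real \<Rightarrow> real \<Rightarrow> 'a vfield" where
  "lincomb a b c d = a \<odot> X \<oplus> b \<odot> Y \<oplus> c \<odot> Z \<oplus> d \<odot> W"

lemma lincomb_simps:
  "vzero = lincomb 0 0 0 0"
  "a \<odot> X = lincomb a 0 0 0" "a \<odot> Y = lincomb 0 a 0 0" "a \<odot> Z = lincomb 0 0 a 0" "a \<odot> W = lincomb 0 0 0 a"
  "lincomb a b c d \<oplus> lincomb a' b' c' d' = lincomb (a + a') (b + b') (c + c') (d + d')"
  by (simp_all add: lincomb_def vzero_def vadd_def vscale_def algebra_simps)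

lemma lincomb_field: "lincomb a b c d = field (\<lambda>i p. [a, b, c, d] ! i)"
  by (simp add: lincomb_def field_def comb_def vadd_def vscale_def)

text \<open>With the six brackets instantiated by unification, these equivalences act as rewrite rules that
  turn a bracket table directly into equations between parameters.\<close>

lemma structure_constant_criteria:
  assumes "lie_bracket A W Z = lincomb p0 p1 p2 p3" "lie_bracket A Z X = lincomb q0 q1 q2 q3"
    "lie_bracket A Z Y = lincomb s0 s1 s2 s3" "lie_bracket A W X = lincomb t0 t1 t2 t3"
    "lie_bracket A W Y = lincomb m0 m1 m2 m3" "lie_bracket A Y X = lincomb n0 n1 n2 n3"
  shows "almost_kahler A g J \<longleftrightarrow> n3 + q0 + s1 = 0 \<and> n2 = t0 + m1 \<and> q2 + t3 = p1 \<and> s2 + m3 + p0 = 0"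
    and "integrable_acs A J \<longleftrightarrow> t1 + m0 = q0 - s1 \<and> m1 - t0 = q1 + s0 \<and>
      t3 + m2 = q2 - s3 \<and> m3 - t2 = q3 + s2"
proof -
  interpret lie_frame A g J X Y Z W "(!) [p0, p1, p2, p3]" "(!) [q0, q1, q2, q3]"
    "(!) [s0, s1, s2, s3]" "(!) [t0, t1, t2, t3]" "(!) [m0, m1, m2, m3]" "(!) [n0, n1, n2, n3]"
    using assms by unfold_locales (simp_all add: lincomb_field)
  show "almost_kahler A g J \<longleftrightarrow> n3 + q0 + s1 = 0 \<and> n2 = t0 + m1 \<and> q2 + t3 = p1 \<and> s2 + m3 + p0 = 0"
    by (simp add: almost_kahler_iff)
  show "integrable_acs A J \<longleftrightarrow> t1 + m0 = q0 - s1 \<and> m1 - t0 = q1 + s0 \<and>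
      t3 + m2 = q2 - s3 \<and> m3 - t2 = q3 + s2"
    by (simp add: integrable_iff)
qed

lemma family1_conditions:
  assumes "family1 l r w1 w2 (lie_bracket A) X Y Z W"
  shows "(almost_kahler A g J \<longleftrightarrow> w1 = 0) \<and>
    (integrable_acs A J \<longleftrightarrow> w1 = 0 \<and> w2 = 0) \<and>
    (kahler A g J \<longleftrightarrow> w1 = 0 \<and> w2 = 0)"
  using assms
  by (simp add: kahler_def structure_constant_criteria lincomb_simps family1_def) auto

lemma family2_conditions:
  assumes "family2 l \<alpha> \<beta> w1 w2 (lie_bracket A) X Y Z W"
  shows "(almost_kahler A g J \<longleftrightarrow> \<alpha> = 0) \<and>
    (integrable_acs A J \<longleftrightarrow> w1 = 0 \<and> w2 = 0) \<and>
    (kahler A g J \<longleftrightarrow> \<alpha> = 0 \<and> w1 = 0 \<and> w2 = 0)"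
  using assms
  by (simp add: kahler_def structure_constant_criteria lincomb_simps family2_def) auto

lemma family3_conditions:
  assumes "family3 \<alpha> \<beta> w1 w2 \<theta>2 (lie_bracket A) X Y Z W"
  shows "(almost_kahler A g J \<longleftrightarrow> \<theta>2 = - 2 * \<alpha> \<and> - 2 * \<alpha> \<noteq> 0) \<and>
    (integrable_acs A J \<longleftrightarrow> w1 = 0 \<and> w2 = 0) \<and>
    (kahler A g J \<longleftrightarrow> \<theta>2 = - 2 * \<alpha> \<and> - 2 * \<alpha> \<noteq> 0 \<and> w1 = 0 \<and> w2 = 0)"
  using assms
  by (simp add: kahler_def structure_constant_criteria lincomb_simps family3_def) (auto; linarith)

text \<open>If both properties held, then $2\lambda^2 = z_2 w_1 = -2z_2^2$, although $\lambda \neq 0$.\<close>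

lemma family4_conditions:
  assumes "family4 l z2 w1 w2 (lie_bracket A) X Y Z W"
  shows "(almost_kahler A g J \<longleftrightarrow> 2 * l^2 = z2 * w1) \<and>
    (integrable_acs A J \<longleftrightarrow> 2 * z2 + w1 = 0 \<and> w2 = 0) \<and>
    \<not> kahler A g J"
proof -
  have l: "l \<noteq> 0" using assms by (simp add: family4_def)
  have AK: "almost_kahler A g J \<longleftrightarrow> 2 * l = z2 * w1 / l"
    and I: "integrable_acs A J \<longleftrightarrow> 2 * z2 + w1 = 0 \<and> w2 = 0"
    using assms by (simp_all add: structure_constant_criteria lincomb_simps family4_def) auto
  have AK': "almost_kahler A g J \<longleftrightarrow> 2 * l^2 = z2 * w1"
    unfolding AK using l by (simp add: field_simps power2_eq_square)
  have "\<not> kahler A g J"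
  proof
    assume "kahler A g J"
    then have "2 * l^2 = z2 * w1" "w1 = - 2 * z2" by (auto simp: kahler_def AK' I)
    then have "l^2 + z2^2 = 0" by (simp add: power2_eq_square)
    with l show False by (simp add: sum_power2_eq_zero_iff)
  qed
  with AK' I show ?thesis by blast
qed

text \<open>With the determinant $D = a\beta - \alpha b$ of the parameters, the closedness equations are
  $r^2 + 4D = 0$ multiplied by $\alpha$ and by $a$, which are not both 0. The integrability equations
  reduce to $(\alpha + b)(a - \beta) = 0$ and $(a-\beta)^2 = (\alpha+b)^2$, which say that the
  square of $(a - \beta) + i(\alpha + b)$ vanishes. If both properties held, $D$ would be
  $\alpha^2 + \beta^2$ and $r^2 = -4D$ negative.\<close>

lemma family5_conditions:
  assumes "family5 \<alpha> a \<beta> b r (lie_bracket A) X Y Z W"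
  shows "(almost_kahler A g J \<longleftrightarrow> r^2 = 4 * (\<alpha> * b - a * \<beta>)) \<and>
    (integrable_acs A J \<longleftrightarrow> a = \<beta> \<and> b = - \<alpha>) \<and>
    \<not> kahler A g J"
proof -
  define D where "D = a * \<beta> - \<alpha> * b"
  note f = assms[unfolded family5_def, folded D_def]
  have r: "r \<noteq> 0" and D: "D \<noteq> 0" using f by auto
  have AK: "almost_kahler A g J \<longleftrightarrow> \<alpha> * (r^2 + 4 * D) = 0 \<and> a * (r^2 + 4 * D) = 0"
  proof -
    have "almost_kahler A g J \<longleftrightarrow> \<alpha> * r^2 / (2 * D) + \<alpha> + \<alpha> = 0 \<and> - (a * r^2 / (2 * D)) = a + a \<and>
        r * (\<beta> * b - \<alpha> * a) / (2 * D) + r * (\<alpha> * a - \<beta> * b) / (2 * D) = 0"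
      using f by (simp add: structure_constant_criteria lincomb_simps)
    also have "\<dots> \<longleftrightarrow> \<alpha> * (r^2 + 4 * D) = 0 \<and> a * (r^2 + 4 * D) = 0"
    proof -
      have "\<alpha> * r^2 / (2 * D) + \<alpha> + \<alpha> = \<alpha> * (r^2 + 4 * D) / (2 * D)"
        "a + a + a * r^2 / (2 * D) = a * (r^2 + 4 * D) / (2 * D)"
        using D by (simp_all add: field_simps)
      moreover have "r * (\<beta> * b - \<alpha> * a) / (2 * D) + r * (\<alpha> * a - \<beta> * b) / (2 * D) = 0"
        by (simp add: add_divide_distrib[symmetric] algebra_simps)
      moreover have "- (a * r^2 / (2 * D)) = a + a \<longleftrightarrow> a + a + a * r^2 / (2 * D) = 0"
        by linarith
      ultimately show ?thesis using D by simp
    qed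
    finally show ?thesis .
  qed
  have AK': "almost_kahler A g J \<longleftrightarrow> r^2 = 4 * (\<alpha> * b - a * \<beta>)"
  proof -
    have "\<alpha> \<noteq> 0 \<or> a \<noteq> 0" using D by (auto simp: D_def)
    then have "almost_kahler A g J \<longleftrightarrow> r^2 + 4 * D = 0" unfolding AK by auto
    then show ?thesis by (simp add: D_def) linarith
  qed
  have I: "integrable_acs A J \<longleftrightarrow> (\<alpha> + b) * (a - \<beta>) = 0 \<and> (a - \<beta>)^2 = (\<alpha> + b)^2"
  proof -
    let ?l2 = "r * (\<alpha> * a - \<beta> * b) / (2 * D) + r * a * b / D"
    let ?r2 = "r * (\<beta> * b - \<alpha> * a) / (2 * D) - - (r * \<alpha> * \<beta> / D)"
    let ?l3 = "- (r * (\<alpha> * b + \<beta> * a) / (2 * D)) - r * (b^2 - a^2) / (2 * D)"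
    let ?r3 = "r * (\<alpha>^2 - \<beta>^2) / (2 * D) + r * (\<alpha> * b + \<beta> * a) / (2 * D)"
    have "integrable_acs A J \<longleftrightarrow> ?l2 = ?r2 \<and> ?l3 = ?r3"
      using f by (simp add: structure_constant_criteria lincomb_simps)
    moreover have "?l2 - ?r2 = r / D * ((\<alpha> + b) * (a - \<beta>))"
      using D by (simp add: field_simps)
    moreover have "?l3 - ?r3 = r / (2 * D) * ((a - \<beta>)^2 - (\<alpha> + b)^2)"
      using D by (simp add: field_simps power2_eq_square)
    ultimately have "integrable_acs A J \<longleftrightarrow> r / D * ((\<alpha> + b) * (a - \<beta>)) = 0 \<and>
        r / (2 * D) * ((a - \<beta>)^2 - (\<alpha> + b)^2) = 0"
      by (metis eq_iff_diff_eq_0)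
    then show ?thesis using r D by auto
  qed
  have I': "integrable_acs A J \<longleftrightarrow> a = \<beta> \<and> b = - \<alpha>"
    unfolding I by (auto simp: add_eq_0_iff)
  have "\<not> kahler A g J"
  proof
    assume "kahler A g J"
    then have "r^2 = 4 * (\<alpha> * b - a * \<beta>)" "a = \<beta>" "b = - \<alpha>" by (auto simp: kahler_def AK' I')
    then have "r^2 + 4 * \<alpha>^2 + 4 * \<beta>^2 = 0" by (simp add: power2_eq_square)
    with r show False by (smt (verit) zero_less_power2 zero_le_power2)
  qed
  with AK' I' show ?thesis by blast
qed

text \<open>The second integrability equation determines $z_2$. The first one is
  $r(z_1^2+z_3^2) = 4z_1^2z_3 + 2z_2(z_1^2-z_3^2)$; after inserting $z_2$ and multiplying by $z_3$ its
  right-hand side becomes $4z_1^2z_3^2 + (z_1^2-z_3^2)^2 = (z_1^2+z_3^2)^2$, so a factor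
  $z_1^2+z_3^2$ cancels.\<close>

lemma family6_conditions:
  assumes "family6 z1 z2 z3 r \<theta>1 \<theta>2 (lie_bracket A) X Y Z W"
  shows "(almost_kahler A g J \<longleftrightarrow> \<theta>1 = 0 \<and> \<theta>2 = 0) \<and>
    (integrable_acs A J \<longleftrightarrow> r = (z1^2 + z3^2) / z3 \<and> z2 = (z1^2 - z3^2) / (2 * z3)) \<and>
    (kahler A g J \<longleftrightarrow> \<theta>1 = 0 \<and> \<theta>2 = 0 \<and> r = (z1^2 + z3^2) / z3 \<and> z2 = (z1^2 - z3^2) / (2 * z3))"
proof -
  have nz: "z1 \<noteq> 0" "z3 \<noteq> 0" using assms by (simp_all add: family6_def)
  have AK: "almost_kahler A g J \<longleftrightarrow> \<theta>1 = 0 \<and> \<theta>2 = 0"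
    using assms by (simp add: structure_constant_criteria lincomb_simps family6_def) auto
  have eq: "z3 * (r + 2 * z2) / (2 * z1) - (2 * z1 - z1 * (r - 2 * z2) / (2 * z3)) =
      (r * (z1^2 + z3^2) - (4 * z1^2 * z3 + 2 * z2 * (z1^2 - z3^2))) / (2 * z1 * z3)"
    "- z3 - (2 * z2 - z1^2 / z3) = (z1^2 - z3^2 - 2 * z2 * z3) / z3"
    using nz by (simp_all add: field_simps power2_eq_square)
  have "integrable_acs A J \<longleftrightarrow> z3 * (r + 2 * z2) / (2 * z1) = 2 * z1 - z1 * (r - 2 * z2) / (2 * z3) \<and>
      - z3 = 2 * z2 - z1^2 / z3"
    using assms by (simp add: structure_constant_criteria lincomb_simps family6_def)
  also have "\<dots> \<longleftrightarrow> (r * (z1^2 + z3^2) - (4 * z1^2 * z3 + 2 * z2 * (z1^2 - z3^2))) / (2 * z1 * z3) = 0 \<and>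
      (z1^2 - z3^2 - 2 * z2 * z3) / z3 = 0"
    unfolding eq[symmetric] by simp
  also have "\<dots> \<longleftrightarrow> r * (z1^2 + z3^2) = 4 * z1^2 * z3 + 2 * z2 * (z1^2 - z3^2) \<and> 2 * z2 * z3 = z1^2 - z3^2"
    using nz by auto
  also have "\<dots> \<longleftrightarrow> r * z3 = z1^2 + z3^2 \<and> 2 * z2 * z3 = z1^2 - z3^2"
  proof -
    have "r * (z1^2 + z3^2) = 4 * z1^2 * z3 + 2 * z2 * (z1^2 - z3^2) \<longleftrightarrow> r * z3 = z1^2 + z3^2"
      if z2: "2 * z2 * z3 = z1^2 - z3^2"
    proof -
      have "z3 * (4 * z1^2 * z3 + 2 * z2 * (z1^2 - z3^2)) = 4 * z1^2 * z3^2 + (2 * z2 * z3) * (z1^2 - z3^2)"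
        by (simp add: algebra_simps power2_eq_square)
      also have "\<dots> = (z1^2 + z3^2) * (z1^2 + z3^2)"
        unfolding z2 by (simp add: algebra_simps)
      finally have "z3 * (r * (z1^2 + z3^2) - (4 * z1^2 * z3 + 2 * z2 * (z1^2 - z3^2))) =
          (z1^2 + z3^2) * (r * z3 - (z1^2 + z3^2))"
        by (simp add: algebra_simps)
      moreover have "z1^2 + z3^2 \<noteq> 0" using nz by (simp add: sum_power2_eq_zero_iff)
      ultimately show ?thesis using nz by (metis eq_iff_diff_eq_0 mult_eq_0_iff)
    qed
    then show ?thesis by blast
  qed
  also have "\<dots> \<longleftrightarrow> r = (z1^2 + z3^2) / z3 \<and> z2 = (z1^2 - z3^2) / (2 * z3)"
    using nz by (auto simp: field_simps)
  finally have "integrable_acs A J \<longleftrightarrow> r = (z1^2 + z3^2) / z3 \<and> z2 = (z1^2 - z3^2) / (2 * z3)" .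
  with AK show ?thesis by (simp add: kahler_def)
qed

lemma family7_conditions:
  assumes "family7 z2 w1 w2 \<theta>1 \<theta>2 (lie_bracket A) X Y Z W"
  shows "(almost_kahler A g J \<longleftrightarrow> \<theta>1 = 0 \<and> \<theta>2 = 0) \<and>
    (integrable_acs A J \<longleftrightarrow> 2 * z2 + w1 = 0 \<and> w2 = 0) \<and>
    (kahler A g J \<longleftrightarrow> \<theta>1 = 0 \<and> \<theta>2 = 0 \<and> 2 * z2 + w1 = 0 \<and> w2 = 0)"
  using assms
  by (simp add: kahler_def structure_constant_criteria lincomb_simps family7_def) auto

lemma family8_conditions:
  assumes "family8 z2 z4 w2 r \<theta>1 \<theta>2 (lie_bracket A) X Y Z W"
  shows "(almost_kahler A g J \<longleftrightarrow> \<theta>1 = 0 \<and> \<theta>2 = 0) \<and>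
    (integrable_acs A J \<longleftrightarrow> 2 * z2 = 0 \<and> z4 + w2 = 0) \<and>
    (kahler A g J \<longleftrightarrow> \<theta>1 = 0 \<and> \<theta>2 = 0 \<and> 2 * z2 = 0 \<and> z4 + w2 = 0)"
  using assms
  by (simp add: kahler_def structure_constant_criteria lincomb_simps family8_def) auto

lemma family9_conditions:
  assumes "family9 z2 z3 z4 \<theta>1 \<theta>2 (lie_bracket A) X Y Z W"
  shows "(almost_kahler A g J \<longleftrightarrow> \<theta>1 = 0 \<and> \<theta>2 = 0) \<and>
    (integrable_acs A J \<longleftrightarrow> z3 - (- 2 * z2) = 0 \<and> z4 = 0) \<and>
    (kahler A g J \<longleftrightarrow> \<theta>1 = 0 \<and> \<theta>2 = 0 \<and> z3 - (- 2 * z2) = 0 \<and> z4 = 0)"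
  using assms
  by (simp add: kahler_def structure_constant_criteria lincomb_simps family9_def) auto

lemma family10_conditions:
  assumes "family10 \<alpha> a \<beta> b (lie_bracket A) X Y Z W"
  shows "\<not> almost_kahler A g J \<and>
    integrable_acs A J \<and>
    \<not> kahler A g J"
  using assms
  by (simp add: kahler_def structure_constant_criteria lincomb_simps family10_def) auto

text \<open>Eliminating $z_3 + w_1 = -2z_2$ from the integrability equations leaves $z_1^2 + z_2^2 = 0$.\<close>

lemma family11_conditions:
  assumes "family11 z1 z2 z3 w1 \<theta>1 \<theta>2 (lie_bracket A) X Y Z W"
  shows "(almost_kahler A g J \<longleftrightarrow> \<theta>1 = 0 \<and> \<theta>2 = 0) \<and>
    \<not> integrable_acs A J \<and>
    \<not> kahler A g J"
proof -
  have z1: "z1 \<noteq> 0" using assms by (simp add: family11_def)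
  have AK: "almost_kahler A g J \<longleftrightarrow> \<theta>1 = 0 \<and> \<theta>2 = 0"
    using assms by (simp add: structure_constant_criteria lincomb_simps family11_def) auto
  have I: "integrable_acs A J \<longleftrightarrow> z2 * z3 / z1 = 2 * z1 - z2 * w1 / z1 \<and> - z3 = 2 * z2 + w1"
    using assms by (simp add: structure_constant_criteria lincomb_simps family11_def)
  have "\<not> integrable_acs A J"
  proof
    assume "integrable_acs A J"
    then have "z2 * z3 = 2 * z1^2 - z2 * w1" and "z3 = - 2 * z2 - w1"
      using z1 by (auto simp: I field_simps power2_eq_square)
    then have "z1^2 + z2^2 = 0" by algebra
    with z1 show False by (simp add: sum_power2_eq_zero_iff)
  qed
  with AK show ?thesis by (simp add: kahler_def)
qed

lemma family12_conditions:
  assumes "family12 z3 w1 w2 \<theta>1 \<theta>2 (lie_bracket A) X Y Z W"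
  shows "(almost_kahler A g J \<longleftrightarrow> \<theta>1 = 0 \<and> \<theta>2 = 0) \<and>
    (integrable_acs A J \<longleftrightarrow> z3 = - w1 \<and> - w1 \<noteq> 0) \<and>
    (kahler A g J \<longleftrightarrow> \<theta>1 = 0 \<and> \<theta>2 = 0 \<and> z3 = - w1 \<and> - w1 \<noteq> 0)"
  using assms
  by (simp add: kahler_def structure_constant_criteria lincomb_simps family12_def) auto

lemma family13_conditions:
  assumes "family13 z3 z4 \<theta>1 \<theta>2 (lie_bracket A) X Y Z W"
  shows "(almost_kahler A g J \<longleftrightarrow> \<theta>1 = 0 \<and> \<theta>2 = 0) \<and>
    \<not> integrable_acs A J \<and>
    \<not> kahler A g J"
  using assms
  by (simp add: kahler_def structure_constant_criteria lincomb_simps family13_def) auto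

lemma family14_conditions:
  assumes "family14 z2 z4 w2 \<theta>1 \<theta>2 (lie_bracket A) X Y Z W"
  shows "(almost_kahler A g J \<longleftrightarrow> \<theta>1 = 0 \<and> \<theta>2 = 0) \<and>
    (integrable_acs A J \<longleftrightarrow> z2 = 0 \<and> z4 + w2 = 0) \<and>
    (kahler A g J \<longleftrightarrow> \<theta>1 = 0 \<and> \<theta>2 = 0 \<and> z2 = 0 \<and> z4 + w2 = 0)"
  using assms
  by (simp add: kahler_def structure_constant_criteria lincomb_simps family14_def) auto

lemma family15_conditions:
  assumes "family15 \<alpha> w1 w2 (lie_bracket A) X Y Z W"
  shows "\<not> almost_kahler A g J \<and>
    (integrable_acs A J \<longleftrightarrow> w1 = 0 \<and> w2 = 0) \<and>
    \<not> kahler A g J"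
  using assms
  by (simp add: kahler_def structure_constant_criteria lincomb_simps family15_def) auto

lemma family16_conditions:
  assumes "family16 \<beta> w1 w2 \<theta>1 \<theta>2 (lie_bracket A) X Y Z W"
  shows "(almost_kahler A g J \<longleftrightarrow> \<theta>1 = 0 \<and> \<theta>2 = 0) \<and>
    (integrable_acs A J \<longleftrightarrow> w1 = 0 \<and> w2 = 0) \<and>
    (kahler A g J \<longleftrightarrow> \<theta>1 = 0 \<and> \<theta>2 = 0 \<and> w1 = 0 \<and> w2 = 0)"
  using assms
  by (simp add: kahler_def structure_constant_criteria lincomb_simps family16_def) auto

lemma family17_conditions:
  assumes "family17 \<alpha> a w1 w2 (lie_bracket A) X Y Z W"
  shows "\<not> almost_kahler A g J \<and>
    (integrable_acs A J \<longleftrightarrow> w1 = 0 \<and> w2 = 0) \<and>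
    \<not> kahler A g J"
proof -
  have AK: "\<not> almost_kahler A g J"
    using assms by (simp add: structure_constant_criteria lincomb_simps family17_def)
  have "integrable_acs A J \<longleftrightarrow> 2 * (a * w1) / \<alpha> - a\<^sup>2 * w2 / \<alpha>\<^sup>2 = - w2 \<and> 2 * (a * w2) / \<alpha> + a\<^sup>2 * w1 / \<alpha>\<^sup>2 = w1"
    using assms by (simp add: structure_constant_criteria lincomb_simps family17_def)
  also have "\<dots> \<longleftrightarrow> w1 = 0 \<and> w2 = 0"
    using conformal_rotation_eq_zero[of "a / \<alpha>" w1 w2] by (simp add: power_divide algebra_simps)
  finally show ?thesis using AK by (simp add: kahler_def)
qed

lemma family18_conditions:
  assumes "family18 \<beta> b z3 z4 \<theta>1 \<theta>2 (lie_bracket A) X Y Z W"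
  shows "(almost_kahler A g J \<longleftrightarrow> \<theta>1 = 0 \<and> \<theta>2 = 0) \<and>
    (integrable_acs A J \<longleftrightarrow> z3 = 0 \<and> z4 = 0) \<and>
    (kahler A g J \<longleftrightarrow> \<theta>1 = 0 \<and> \<theta>2 = 0 \<and> z3 = 0 \<and> z4 = 0)"
proof -
  have AK: "almost_kahler A g J \<longleftrightarrow> \<theta>1 = 0 \<and> \<theta>2 = 0"
    using assms by (simp add: structure_constant_criteria lincomb_simps family18_def) auto
  have "integrable_acs A J \<longleftrightarrow> z4 = 2 * (\<beta> * z3) / b + \<beta>\<^sup>2 * z4 / b\<^sup>2 \<and> - z3 = 2 * (\<beta> * z4) / b - \<beta>\<^sup>2 * z3 / b\<^sup>2"
    using assms by (simp add: structure_constant_criteria lincomb_simps family18_def)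
  also have "\<dots> \<longleftrightarrow> z3 = 0 \<and> z4 = 0"
    using conformal_rotation_eq_zero[of "\<beta> / b" z4 z3] by (simp add: power_divide algebra_simps) (linarith)
  finally show ?thesis using AK by (simp add: kahler_def)
qed

lemma family19_conditions:
  assumes "family19 \<alpha> \<beta> w1 w2 (lie_bracket A) X Y Z W"
  shows "\<not> almost_kahler A g J \<and>
    (integrable_acs A J \<longleftrightarrow> w1 = 0 \<and> w2 = 0) \<and>
    \<not> kahler A g J"
  using assms
  by (simp add: kahler_def structure_constant_criteria lincomb_simps family19_def) auto

lemma family20_conditions:
  assumes "family20 \<alpha> a \<beta> w1 w2 (lie_bracket A) X Y Z W"
  shows "\<not> almost_kahler A g J \<and>
    (integrable_acs A J \<longleftrightarrow> w1 = 0 \<and> w2 = 0) \<and>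
    \<not> kahler A g J"
proof -
  have AK: "\<not> almost_kahler A g J"
    using assms by (simp add: structure_constant_criteria lincomb_simps family20_def)
  have "integrable_acs A J \<longleftrightarrow> 2 * (a * w1) / \<alpha> - a\<^sup>2 * w2 / \<alpha>\<^sup>2 = - w2 \<and> 2 * (a * w2) / \<alpha> + a\<^sup>2 * w1 / \<alpha>\<^sup>2 = w1"
    using assms by (simp add: structure_constant_criteria lincomb_simps family20_def)
  also have "\<dots> \<longleftrightarrow> w1 = 0 \<and> w2 = 0"
    using conformal_rotation_eq_zero[of "a / \<alpha>" w1 w2] by (simp add: power_divide algebra_simps)
  finally show ?thesis using AK by (simp add: kahler_def)
qed

end
theorem mainTheorem1:
  fixes mul :: "'a::{t2_space, second_countable_topology} \<Rightarrow> 'a \<Rightarrow> 'a"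
    and e :: 'a and iv :: "'a \<Rightarrow> 'a" and A :: "'a atlas"
    and g :: "'a tensor2" and J :: "'a endo" and X Y Z W :: "'a vfield"
  assumes "lie_group4 mul e iv A"
    and "left_invariant_metric mul A g"
    and "orthonormal_lie_basis mul A g X Y Z W"
    and "left_invariant_almost_complex mul A J"
    and "apply_endo J X = Y" and "apply_endo J Y = (-1) \<odot> X"
    and "apply_endo J Z = W" and "apply_endo J W = (-1) \<odot> Z"
  shows
    "(\<forall>l r w1 w2. family1 l r w1 w2 (lie_bracket A) X Y Z W \<longrightarrow>
        (almost_kahler A g J \<longleftrightarrow> w1 = 0) \<and>
        (integrable_acs A J \<longleftrightarrow> w1 = 0 \<and> w2 = 0) \<and>
        (kahler A g J \<longleftrightarrow> w1 = 0 \<and> w2 = 0)) \<and>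
     (\<forall>l \<alpha> \<beta> w1 w2. family2 l \<alpha> \<beta> w1 w2 (lie_bracket A) X Y Z W \<longrightarrow>
        (almost_kahler A g J \<longleftrightarrow> \<alpha> = 0) \<and>
        (integrable_acs A J \<longleftrightarrow> w1 = 0 \<and> w2 = 0) \<and>
        (kahler A g J \<longleftrightarrow> \<alpha> = 0 \<and> w1 = 0 \<and> w2 = 0)) \<and>
     (\<forall>\<alpha> \<beta> w1 w2 \<theta>2. family3 \<alpha> \<beta> w1 w2 \<theta>2 (lie_bracket A) X Y Z W \<longrightarrow>
        (almost_kahler A g J \<longleftrightarrow> \<theta>2 = - 2 * \<alpha> \<and> - 2 * \<alpha> \<noteq> 0) \<and>
        (integrable_acs A J \<longleftrightarrow> w1 = 0 \<and> w2 = 0) \<and>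
        (kahler A g J \<longleftrightarrow> \<theta>2 = - 2 * \<alpha> \<and> - 2 * \<alpha> \<noteq> 0 \<and> w1 = 0 \<and> w2 = 0)) \<and>
     (\<forall>l z2 w1 w2. family4 l z2 w1 w2 (lie_bracket A) X Y Z W \<longrightarrow>
        (almost_kahler A g J \<longleftrightarrow> 2 * l^2 = z2 * w1) \<and>
        (integrable_acs A J \<longleftrightarrow> 2 * z2 + w1 = 0 \<and> w2 = 0) \<and>
        \<not> kahler A g J) \<and>
     (\<forall>\<alpha> a \<beta> b r. family5 \<alpha> a \<beta> b r (lie_bracket A) X Y Z W \<longrightarrow>
        (almost_kahler A g J \<longleftrightarrow> r^2 = 4 * (\<alpha> * b - a * \<beta>)) \<and>
        (integrable_acs A J \<longleftrightarrow> a = \<beta> \<and> b = - \<alpha>) \<and>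
        \<not> kahler A g J) \<and>
     (\<forall>z1 z2 z3 r \<theta>1 \<theta>2. family6 z1 z2 z3 r \<theta>1 \<theta>2 (lie_bracket A) X Y Z W \<longrightarrow>
        (almost_kahler A g J \<longleftrightarrow> \<theta>1 = 0 \<and> \<theta>2 = 0) \<and>
        (integrable_acs A J \<longleftrightarrow> r = (z1^2 + z3^2) / z3 \<and> z2 = (z1^2 - z3^2) / (2 * z3)) \<and>
        (kahler A g J \<longleftrightarrow> \<theta>1 = 0 \<and> \<theta>2 = 0 \<and> r = (z1^2 + z3^2) / z3 \<and> z2 = (z1^2 - z3^2) / (2 * z3))) \<and>
     (\<forall>z2 w1 w2 \<theta>1 \<theta>2. family7 z2 w1 w2 \<theta>1 \<theta>2 (lie_bracket A) X Y Z W \<longrightarrow>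
        (almost_kahler A g J \<longleftrightarrow> \<theta>1 = 0 \<and> \<theta>2 = 0) \<and>
        (integrable_acs A J \<longleftrightarrow> 2 * z2 + w1 = 0 \<and> w2 = 0) \<and>
        (kahler A g J \<longleftrightarrow> \<theta>1 = 0 \<and> \<theta>2 = 0 \<and> 2 * z2 + w1 = 0 \<and> w2 = 0)) \<and>
     (\<forall>z2 z4 w2 r \<theta>1 \<theta>2. family8 z2 z4 w2 r \<theta>1 \<theta>2 (lie_bracket A) X Y Z W \<longrightarrow>
        (almost_kahler A g J \<longleftrightarrow> \<theta>1 = 0 \<and> \<theta>2 = 0) \<and>
        (integrable_acs A J \<longleftrightarrow> 2 * z2 = 0 \<and> z4 + w2 = 0) \<and>
        (kahler A g J \<longleftrightarrow> \<theta>1 = 0 \<and> \<theta>2 = 0 \<and> 2 * z2 = 0 \<and> z4 + w2 = 0)) \<and>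
     (\<forall>z2 z3 z4 \<theta>1 \<theta>2. family9 z2 z3 z4 \<theta>1 \<theta>2 (lie_bracket A) X Y Z W \<longrightarrow>
        (almost_kahler A g J \<longleftrightarrow> \<theta>1 = 0 \<and> \<theta>2 = 0) \<and>
        (integrable_acs A J \<longleftrightarrow> z3 - (- 2 * z2) = 0 \<and> z4 = 0) \<and>
        (kahler A g J \<longleftrightarrow> \<theta>1 = 0 \<and> \<theta>2 = 0 \<and> z3 - (- 2 * z2) = 0 \<and> z4 = 0)) \<and>
     (\<forall>\<alpha> a \<beta> b. family10 \<alpha> a \<beta> b (lie_bracket A) X Y Z W \<longrightarrow>
        \<not> almost_kahler A g J \<and>
        integrable_acs A J \<and>
        \<not> kahler A g J) \<and>
     (\<forall>z1 z2 z3 w1 \<theta>1 \<theta>2. family11 z1 z2 z3 w1 \<theta>1 \<theta>2 (lie_bracket A) X Y Z W \<longrightarrow>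
        (almost_kahler A g J \<longleftrightarrow> \<theta>1 = 0 \<and> \<theta>2 = 0) \<and>
        \<not> integrable_acs A J \<and>
        \<not> kahler A g J) \<and>
     (\<forall>z3 w1 w2 \<theta>1 \<theta>2. family12 z3 w1 w2 \<theta>1 \<theta>2 (lie_bracket A) X Y Z W \<longrightarrow>
        (almost_kahler A g J \<longleftrightarrow> \<theta>1 = 0 \<and> \<theta>2 = 0) \<and>
        (integrable_acs A J \<longleftrightarrow> z3 = - w1 \<and> - w1 \<noteq> 0) \<and>
        (kahler A g J \<longleftrightarrow> \<theta>1 = 0 \<and> \<theta>2 = 0 \<and> z3 = - w1 \<and> - w1 \<noteq> 0)) \<and>
     (\<forall>z3 z4 \<theta>1 \<theta>2. family13 z3 z4 \<theta>1 \<theta>2 (lie_bracket A) X Y Z W \<longrightarrow>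
        (almost_kahler A g J \<longleftrightarrow> \<theta>1 = 0 \<and> \<theta>2 = 0) \<and>
        \<not> integrable_acs A J \<and>
        \<not> kahler A g J) \<and>
     (\<forall>z2 z4 w2 \<theta>1 \<theta>2. family14 z2 z4 w2 \<theta>1 \<theta>2 (lie_bracket A) X Y Z W \<longrightarrow>
        (almost_kahler A g J \<longleftrightarrow> \<theta>1 = 0 \<and> \<theta>2 = 0) \<and>
        (integrable_acs A J \<longleftrightarrow> z2 = 0 \<and> z4 + w2 = 0) \<and>
        (kahler A g J \<longleftrightarrow> \<theta>1 = 0 \<and> \<theta>2 = 0 \<and> z2 = 0 \<and> z4 + w2 = 0)) \<and>
     (\<forall>\<alpha> w1 w2. family15 \<alpha> w1 w2 (lie_bracket A) X Y Z W \<longrightarrow>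
        \<not> almost_kahler A g J \<and>
        (integrable_acs A J \<longleftrightarrow> w1 = 0 \<and> w2 = 0) \<and>
        \<not> kahler A g J) \<and>
     (\<forall>\<beta> w1 w2 \<theta>1 \<theta>2. family16 \<beta> w1 w2 \<theta>1 \<theta>2 (lie_bracket A) X Y Z W \<longrightarrow>
        (almost_kahler A g J \<longleftrightarrow> \<theta>1 = 0 \<and> \<theta>2 = 0) \<and>
        (integrable_acs A J \<longleftrightarrow> w1 = 0 \<and> w2 = 0) \<and>
        (kahler A g J \<longleftrightarrow> \<theta>1 = 0 \<and> \<theta>2 = 0 \<and> w1 = 0 \<and> w2 = 0)) \<and>
     (\<forall>\<alpha> a w1 w2. family17 \<alpha> a w1 w2 (lie_bracket A) X Y Z W \<longrightarrow>
        \<not> almost_kahler A g J \<and>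
        (integrable_acs A J \<longleftrightarrow> w1 = 0 \<and> w2 = 0) \<and>
        \<not> kahler A g J) \<and>
     (\<forall>\<beta> b z3 z4 \<theta>1 \<theta>2. family18 \<beta> b z3 z4 \<theta>1 \<theta>2 (lie_bracket A) X Y Z W \<longrightarrow>
        (almost_kahler A g J \<longleftrightarrow> \<theta>1 = 0 \<and> \<theta>2 = 0) \<and>
        (integrable_acs A J \<longleftrightarrow> z3 = 0 \<and> z4 = 0) \<and>
        (kahler A g J \<longleftrightarrow> \<theta>1 = 0 \<and> \<theta>2 = 0 \<and> z3 = 0 \<and> z4 = 0)) \<and>
     (\<forall>\<alpha> \<beta> w1 w2. family19 \<alpha> \<beta> w1 w2 (lie_bracket A) X Y Z W \<longrightarrow>
        \<not> almost_kahler A g J \<and>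
        (integrable_acs A J \<longleftrightarrow> w1 = 0 \<and> w2 = 0) \<and>
        \<not> kahler A g J) \<and>
     (\<forall>\<alpha> a \<beta> w1 w2. family20 \<alpha> a \<beta> w1 w2 (lie_bracket A) X Y Z W \<longrightarrow>
        \<not> almost_kahler A g J \<and>
        (integrable_acs A J \<longleftrightarrow> w1 = 0 \<and> w2 = 0) \<and>
        \<not> kahler A g J)"
proof -
  interpret unitary_frame A g J X Y Z W
    using assms
    by unfold_locales
      (auto simp: lie_group4_def left_invariant_metric_def left_invariant_almost_complex_def
        orthonormal_lie_basis_def lie_algebra_def simp del: nth_Cons_0)
  show ?thesis
    by (intro conjI; intro allI impI;
        (erule family1_conditions family2_conditions family3_conditions family4_conditions
          family5_conditions family6_conditions family7_conditions family8_conditions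
          family9_conditions family10_conditions family11_conditions family12_conditions
          family13_conditions family14_conditions family15_conditions family16_conditions
          family17_conditions family18_conditions family19_conditions family20_conditions))
qed

end
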